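(* Let $d\ge 2$ be an integer and let $G=(\mathbb{Z}_d,+)=\{0,1,\dots,d-1\}$ be the additive group of residues modulo $d$. Consider the modular add urn (MAU) model on $G$ described in the context, with random draw sizes $(M_i)_{i\ge1}$ satisfying Assumptions 1 and 2 of the context, started from a finite number $n_0\ge 1$ of balls whose labels generate $G$. For $n\ge 0$ and $j\in\{0,1,\dots,d-1\}$, let $S_{n,j}$ be the number of balls labeled $j$ in the urn after $n$ stages and let $a_{n,j}=S_{n,j}/(n+n_0)$. Then for every $j\in\{0,1,\dots,d-1\}$, $$a_{n,j}\to \frac1d\quad\text{almost surely as } n\to\infty .$$
   Context: The MAU model. The urn contains balls labeled by elements of $G=(\mathbb{Z}_d,+)$. Initially it contains $S_{0,j}$ balls labeled $j$ for $j\in G$ (deterministic nonnegative integers), with $\sum_{j}S_{0,j}=n_0\ge1$, and the set of labels present, $\{j: S_{0,j}>0\}$, generates $G$. At each stage $i=1,2,\dots$, a random number $M_i$ of balls is drawn one at a time with replacement; if their labels are $X_{i1},\dots,X_{iM_i}$, then one new ball with label $Z_i=(X_{i1}+\dots+X_{iM_i}) \bmod d$ is added to the urn (the drawn balls are all returned). Thus $S_{n,j}=S_{0,j}+\sum_{i=1}^n \mathbf 1\{Z_i=j\}$, and the urn contains $n+n_0$ balls after $n$ stages. Let $\mathcal F_n$ be the $\sigma$-field generated by $\{(X_{i1},\dots,X_{iM_i}): i=1,\dots,n\}$ (so $M_1,\dots,M_n$ are $\mathcal F_n$-measurable). Assumption 1. At each stage $i$, conditionally on $\mathcal F_{i-1}$,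 the draws are independent of $M_i$, and given $M_i=m$ the labels $X_{i1},\dots,X_{im}$ are conditionally independent, each equal to $j\in G$ with probability $S_{i-1,j}/(i-1+n_0)$. That is, for every possible value $m$ of $M_i$ and all $x_1,\dots,x_m\in G$, $$P(M_i=m,X_{i1}=x_1,\dots,X_{im}=x_m\mid\mathcal F_{i-1})=P(M_i=m)\prod_{l=1}^m \frac{S_{i-1,x_l}}{i-1+n_0}.$$ Assumption 2. There are integers $c\ge1$, $C\ge2$ and $2\le m_1<m_2<\dots<m_c\le C$ such that $(M_i)_{i\ge1}$ are i.i.d. with $P(M_i=m_s)=p_s>0$ for $s=1,\dots,c$ and $\sum_{s=1}^c p_s=1$. Moreover there is at least one $s\in\{1,\dots,c\}$ with $\gcd(m_s-1,d)=1$. *)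

theory Defs
  imports "HOL-Probability.Probability" "HOL-Algebra.Elementary_Groups"
begin

text \<open>
  The group of labels is \<open>integer_mod_group d\<close>, with carrier \<open>{0..<int d}\<close>.  The random tuple of
  labels drawn at stage \<open>i \<ge> 1\<close> is a single list-valued random variable \<open>X i\<close>, because its length
  is random; \<open>X 0\<close> is never used.
\<close>

definition draw_size :: "(nat \<Rightarrow> 'a \<Rightarrow> int list) \<Rightarrow> nat \<Rightarrow> 'a \<Rightarrow> nat" where
  "draw_size X i \<omega> = length (X i \<omega>)"

definition new_label :: "nat \<Rightarrow> (nat \<Rightarrow> 'a \<Rightarrow> int list) \<Rightarrow> nat \<Rightarrow> 'a \<Rightarrow> int" where
  "new_label d X i \<omega> = sum_list (X i \<omega>) mod int d"

definition initial_balls :: "nat \<Rightarrow> (int \<Rightarrow> nat) \<Rightarrow> nat" where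
  "initial_balls d S0 = (\<Sum>j\<in>carrier (integer_mod_group d). S0 j)"

definition ball_count ::
    "nat \<Rightarrow> (int \<Rightarrow> nat) \<Rightarrow> (nat \<Rightarrow> 'a \<Rightarrow> int list) \<Rightarrow> nat \<Rightarrow> int \<Rightarrow> 'a \<Rightarrow> nat" where
  "ball_count d S0 X n j \<omega> = S0 j + (\<Sum>i=1..n. of_bool (new_label d X i \<omega> = j))"

definition ball_fraction ::
    "nat \<Rightarrow> (int \<Rightarrow> nat) \<Rightarrow> (nat \<Rightarrow> 'a \<Rightarrow> int list) \<Rightarrow> nat \<Rightarrow> int \<Rightarrow> 'a \<Rightarrow> real" where
  "ball_fraction d S0 X n j \<omega> =
     real (ball_count d S0 X n j \<omega>) / real (n + initial_balls d S0)"

definition valid_start :: "nat \<Rightarrow> (int \<Rightarrow> nat) \<Rightarrow> bool" where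
  "valid_start d S0 \<longleftrightarrow>
     initial_balls d S0 \<ge> 1 \<and>
     generate (integer_mod_group d) {j \<in> carrier (integer_mod_group d). S0 j > 0}
       = carrier (integer_mod_group d)"

definition draw_sequence :: "'a measure \<Rightarrow> nat \<Rightarrow> (nat \<Rightarrow> 'a \<Rightarrow> int list) \<Rightarrow> bool" where
  "draw_sequence P d X \<longleftrightarrow>
     (\<forall>i\<ge>1. X i \<in> measurable P (count_space (lists (carrier (integer_mod_group d)))))"

definition draw_history :: "'a measure \<Rightarrow> (nat \<Rightarrow> 'a \<Rightarrow> int list) \<Rightarrow> nat \<Rightarrow> 'a measure" where
  "draw_history P X n = sigma (space P) {X i -` A \<inter> space P | i A. i \<in> {1..n}}"

text \<open>
  The library conditional expectation is meaningful only with respect to a subalgebra, which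
  this is.
\<close>

lemma subalgebra_draw_history:
  assumes "draw_sequence P d X"
  shows "subalgebra P (draw_history P X n)"
proof -
  have "X i -` A \<inter> space P \<in> sets P" if "i \<in> {1..n}" for i A
  proof -
    let ?L = "lists (carrier (integer_mod_group d))"
    have X: "X i \<in> measurable P (count_space ?L)"
      using assms that by (auto simp: draw_sequence_def)
    have "X i -` A \<inter> space P = X i -` (A \<inter> ?L) \<inter> space P"
      using measurable_space[OF X] by auto
    then show ?thesis
      using measurable_sets[OF X, of "A \<inter> ?L"] by simp
  qed
  then have "sigma_sets (space P) {X i -` A \<inter> space P | i A. i \<in> {1..n}} \<subseteq> sets P"
    by (intro sets.sigma_sets_subset) auto
  moreover have "{X i -` A \<inter> space P | i A. i \<in> {1..n}} \<subseteq> Pow (space P)"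
    by blast
  ultimately show ?thesis
    unfolding subalgebra_def draw_history_def by simp
qed

text \<open>
  \<open>P(M\<^sub>i = m, X\<^sub>i\<^sub>1 = x\<^sub>1, \<dots>, X\<^sub>i\<^sub>m = x\<^sub>m | F\<^sub>i\<^sub>-\<^sub>1)\<close> is the conditional expectation of the indicator of
  \<open>X i = xs\<close>, where \<open>xs = [x\<^sub>1, \<dots>, x\<^sub>m]\<close>; this event includes \<open>M\<^sub>i = m\<close>.
\<close>

definition assumption_1 ::
    "'a measure \<Rightarrow> nat \<Rightarrow> (int \<Rightarrow> nat) \<Rightarrow> (nat \<Rightarrow> 'a \<Rightarrow> int list) \<Rightarrow> bool" where
  "assumption_1 P d S0 X \<longleftrightarrow>
     (\<forall>i\<ge>1. \<forall>m. measure P {\<omega> \<in> space P. draw_size X i \<omega> = m} > 0 \<longrightarrow>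
        (\<forall>xs \<in> lists (carrier (integer_mod_group d)). length xs = m \<longrightarrow>
          (AE \<omega> in P.
             real_cond_exp P (draw_history P X (i - 1)) (indicator {\<omega> \<in> space P. X i \<omega> = xs}) \<omega>
               = measure P {\<omega> \<in> space P. draw_size X i \<omega> = m}
                 * (\<Prod>l<m. ball_fraction d S0 X (i - 1) (xs ! l) \<omega>))))"

definition assumption_2 :: "'a measure \<Rightarrow> nat \<Rightarrow> (nat \<Rightarrow> 'a \<Rightarrow> int list) \<Rightarrow> bool" where
  "assumption_2 P d X \<longleftrightarrow>
     prob_space.indep_vars P (\<lambda>_. count_space UNIV) (draw_size X) {1..} \<and>
     (\<exists>(c::nat) (C::nat) (m :: nat \<Rightarrow> nat) (p :: nat \<Rightarrow> real).
        c \<ge> 1 \<and> C \<ge> 2 \<and>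
        (\<forall>s\<in>{1..c}. 2 \<le> m s \<and> m s \<le> C) \<and> strict_mono_on {1..c} m \<and>
        (\<forall>s\<in>{1..c}. p s > 0) \<and> (\<Sum>s=1..c. p s) = 1 \<and>
        (\<forall>i\<ge>1. \<forall>s\<in>{1..c}. measure P {\<omega> \<in> space P. draw_size X i \<omega> = m s} = p s) \<and>
        (\<exists>s\<in>{1..c}. gcd (m s - 1) d = 1))"

end

(*
  For a nontrivial character psi of Z_d let z_n = sum_j a_{n,j} psi(j).  Given the past, the new
  label Z has E psi(Z) = g(z_n) with g(w) = sum_s p_s w^(m_s), so each Fourier mode is a
  one-dimensional stochastic approximation of its own, and |g(w)| <= |w|^2 on the unit disc.
  Hence |z_n|^2 has drift at most -(2/n) |z_n|^2 (1 - |z_n|) up to O(1/n^2), and as the noise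
  series converges almost surely, |z_n| converges to 0 or to 1.

  If |z_n| -> 1, then almost all balls eventually lie in one level set of psi.  Let T be the number
  of balls outside it (plus 1 if psi is not 1 on the set, where T could vanish).  While T/n is small, the next ball
  falls outside with probability at least (7/4) T/n: if psi = 1 on the set since at least two balls
  are drawn, and if psi = v there with v not 1 since v^m is not v when gcd(m - 1, d) = 1.
  Then n/(T - 1/2) contracts in expectation by a factor 1 - 1/(6n) per step while it
  is bounded below, so the concentration almost surely does not persist.
*)
theory Submission
  imports Defs
begin

section \<open>Convergence of almost decreasing sequences and of orthogonal series\<close>

text \<open>The drift of |z_n|^2 vanishes at modulus 0 and also at modulus 1, so the stochastic
  approximation alone cannot exclude 1. That endpoint is degenerate: if nearly all balls have psi =
  1, the next ball has psi = 1 with probability near 1, so the noise fades there and arguments that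
  rely on noise bounded below do not apply. Hence the passage to counts, which stay sensitive to a
  single stray ball. Both hypotheses against degeneracy enter at this point. Since the initial
  labels generate G, some initial ball has psi not 1, and it is never removed. The gcd condition
  rules out v^(m-1) = 1 for v not 1, because v^d = 1; a level set with v^m = v for every size m
  would be absorbing. The growth rate of T has to exceed 1 because the urn itself grows by a factor
  1 + 1/n per step. Two draws give a rate 2(1 - y) with y the fraction outside, hence at least 7/4
  for small y. The shift by 1/2 costs at most a factor 2/3, which leaves 7/6, and the surplus over 1
  is the 1/6 of the contraction. As the harmonic series diverges, even this small gain sends the
  expectation to 0.\<close>

text \<open>A pathwise Robbins-Siegmund lemma. The perturbation \<open>q\<close> may change sign and
  need only sum conditionally, so it can absorb the noise as well as the second-order error.\<close>

lemma almost_decreasing: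
  fixes x w q :: "nat \<Rightarrow> real"
  assumes step: "\<And>n. x (Suc n) \<le> x n - w n + q n"
    and x: "\<And>n. 0 \<le> x n" and w: "\<And>n. 0 \<le> w n" and q: "summable q"
  shows "convergent x" and "summable w"
proof -
  \<comment> \<open>Compensating by the partial sums of \<open>q\<close> and adding back the
    accumulated \<open>w\<close> gives a decreasing sequence; it is bounded below because
    \<open>x\<close> and \<open>w\<close> are nonnegative and the partial sums of \<open>q\<close>
    are bounded.\<close>
  define s where "s n = x n - (\<Sum>i<n. q i) + (\<Sum>i<n. w i)" for n
  have "s (Suc n) \<le> s n" for n
    using step[of n] by (simp add: s_def)
  then have dec: "decseq s"
    by (rule decseq_SucI)
  have "(\<lambda>n. \<Sum>i<n. q i) \<longlonglongrightarrow> suminf q"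
    using q by (rule summable_LIMSEQ)
  then have q_conv: "convergent (\<lambda>n. \<Sum>i<n. q i)"
    by (rule convergentI)
  then obtain B where B: "\<And>n. \<bar>\<Sum>i<n. q i\<bar> \<le> B"
    using Bseq_def convergent_imp_Bseq by (metis real_norm_def)
  have w_nonneg: "0 \<le> (\<Sum>i<n. w i)" for n
    using w by (simp add: sum_nonneg)
  show summ: "summable w"
  proof (rule summableI_nonneg_bounded)
    fix n
    show "(\<Sum>i<n. w i) \<le> s 0 + B"
      using decseqD[OF dec, of 0 n] x[of n] B[of n] by (simp add: s_def)
  qed (rule w)
  have "- B \<le> s n" for n
    using x[of n] B[of n] w_nonneg[of n] by (simp add: s_def)
  then have "convergent s"
    using decseq_convergent[OF dec, of "-B"] by (metis convergent_def)
  moreover have "convergent (\<lambda>n. \<Sum>i<n. w i)"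
    using summ by (auto intro: convergentI summable_LIMSEQ)
  ultimately have "convergent (\<lambda>n. s n + (\<Sum>i<n. q i) - (\<Sum>i<n. w i))"
    using q_conv by (intro convergent_diff convergent_add)
  then show "convergent x"
    by (simp add: s_def)
qed

text \<open>A positive \<open>L\<close> would make the terms eventually at least
  \<open>L / 2\<close> times those of a shifted harmonic series, which diverges.\<close>

lemma limit_zero_if_summable_div:
  fixes f :: "nat \<Rightarrow> real"
  assumes lim: "f \<longlonglongrightarrow> L" and f: "\<And>n. 0 \<le> f n"
    and summ: "summable (\<lambda>n. f n / real (n + c))"
  shows "L = 0"
proof (rule ccontr)
  assume "L \<noteq> 0"
  moreover have "0 \<le> L"
    using lim f by (intro LIMSEQ_le_const) auto
  ultimately have L: "0 < L" by simp
  then have "\<forall>\<^sub>F n in sequentially. f n > L / 2"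
    using lim by (intro order_tendstoD(1)) auto
  then have "\<forall>\<^sub>F n in sequentially. norm (inverse (real (n + c))) \<le> 2 / L * (f n / real (n + c))"
  proof eventually_elim
    case (elim n)
    then have "1 \<le> 2 / L * f n"
      using L by (simp add: field_simps)
    from mult_right_mono[OF this, of "inverse (real (n + c))"] show ?case
      by (simp add: field_simps)
  qed
  then have "summable (\<lambda>n. inverse (real (n + c)))"
    by (rule summable_comparison_test_ev) (intro summable_mult summ)
  then have "summable (\<lambda>n. inverse (real n))"
    by (subst (asm) summable_iff_shift)
  then show False
    using not_summable_harmonic[where 'a=real] by simp
qed

lemma cube_interval:
  fixes n k0 :: nat
  assumes "k0 ^ 3 \<le> n"
  obtains k where "k0 \<le> k" "k ^ 3 \<le> n" "n < Suc k ^ 3"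
proof -
  have bound: "k \<le> n" if "k ^ 3 \<le> n" for k
  proof -
    have "k \<le> k ^ 3"
      by (cases "k = 0") (simp_all add: self_le_power)
    with that show ?thesis by linarith
  qed
  have fin: "finite {k. k ^ 3 \<le> n}"
  proof (rule finite_subset)
    show "{k. k ^ 3 \<le> n} \<subseteq> {..n}"
      using bound by blast
  qed simp
  define k where "k = Max {k. k ^ 3 \<le> n}"
  have "k \<in> {k. k ^ 3 \<le> n}"
    unfolding k_def using assms by (intro Max_in fin) blast
  moreover have "k0 \<le> k"
    unfolding k_def using assms by (intro Max_ge fin) simp
  moreover have "\<not> Suc k ^ 3 \<le> n"
  proof
    assume "Suc k ^ 3 \<le> n"
    then have "Suc k \<le> k"
      unfolding k_def by (intro Max_ge fin) simp
    then show False by simp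
  qed
  ultimately show ?thesis
    using that[of k] by simp
qed

context prob_space
begin

text \<open>By Tonelli the sum has finite expectation, so it is finite almost surely.\<close>

lemma AE_summable_if_expectations_summable:
  fixes f :: "nat \<Rightarrow> 'a \<Rightarrow> real"
  assumes int: "\<And>n. integrable M (f n)" and nonneg: "\<And>n x. 0 \<le> f n x"
    and summ: "summable (\<lambda>n. expectation (f n))"
  shows "AE x in M. summable (\<lambda>n. f n x)"
proof -
  have [measurable]: "f n \<in> borel_measurable M" for n
    using int by auto
  have "(\<integral>\<^sup>+x. (\<Sum>n. ennreal (f n x)) \<partial>M) = (\<Sum>n. \<integral>\<^sup>+x. ennreal (f n x) \<partial>M)"
    by (intro nn_integral_suminf) auto
  also have "\<dots> = (\<Sum>n. ennreal (expectation (f n)))"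
    using int nonneg by (simp add: nn_integral_eq_integral)
  also have "\<dots> \<noteq> \<infinity>"
    using summ nonneg by (subst suminf_ennreal2) (auto intro: integral_nonneg)
  finally have "AE x in M. (\<Sum>n. ennreal (f n x)) \<noteq> \<infinity>"
    by (intro nn_integral_PInf_AE) auto
  then show ?thesis
    by eventually_elim (auto intro: summable_suminf_not_top nonneg)
qed

lemma expectation_square_sum_orthogonal:
  fixes D :: "nat \<Rightarrow> 'a \<Rightarrow> real"
  assumes [measurable]: "\<And>n. D n \<in> borel_measurable M"
    and bound: "\<And>n x. x \<in> space M \<Longrightarrow> \<bar>D n x\<bar> \<le> b n"
    and orth: "\<And>i j. i < j \<Longrightarrow> expectation (\<lambda>x. D i x * D j x) = 0"
    and "finite I"
  shows "expectation (\<lambda>x. (\<Sum>i\<in>I. D i x)\<^sup>2) \<le> (\<Sum>i\<in>I. (b i)\<^sup>2)"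
proof -
  have prod_bound: "\<bar>D i x * D j x\<bar> \<le> b i * b j" if "x \<in> space M" for i j x
    using bound[OF that, of i] bound[OF that, of j] unfolding abs_mult by (intro mult_mono) auto
  have int: "integrable M (\<lambda>x. D i x * D j x)" for i j
    using prod_bound by (intro integrable_const_bound[of _ "b i * b j"]) auto
  have off: "expectation (\<lambda>x. D i x * D j x) = 0" if "i \<noteq> j" for i j
    using that orth[of i j] orth[of j i] by (cases "i < j") (auto simp: mult.commute)
  have "expectation (\<lambda>x. (\<Sum>i\<in>I. D i x)\<^sup>2) = (\<Sum>i\<in>I. \<Sum>j\<in>I. expectation (\<lambda>x. D i x * D j x))"
    using int by (simp add: power2_eq_square sum_product)
  also have "\<dots> = (\<Sum>i\<in>I. \<Sum>j\<in>I. if i = j then expectation (\<lambda>x. D i x * D i x) else 0)"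
    using off by (intro sum.cong) auto
  also have "\<dots> = (\<Sum>i\<in>I. expectation (\<lambda>x. D i x * D i x))"
    using \<open>finite I\<close> by simp
  also have "\<dots> \<le> (\<Sum>i\<in>I. (b i)\<^sup>2)"
  proof (rule sum_mono)
    fix i
    have "D i x * D i x \<le> (b i)\<^sup>2" if "x \<in> space M" for x
      using prod_bound[OF that, of i i] by (simp add: power2_eq_square)
    then have "expectation (\<lambda>x. D i x * D i x) \<le> expectation (\<lambda>x. (b i)\<^sup>2)"
      using int by (intro integral_mono) auto
    then show "expectation (\<lambda>x. D i x * D i x) \<le> (b i)\<^sup>2"
      by (simp add: prob_space)
  qed
  finally show ?thesis .
qed

lemma AE_summable_orthogonal:
  fixes D :: "nat \<Rightarrow> 'a \<Rightarrow> real"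
  assumes meas[measurable]: "\<And>n. D n \<in> borel_measurable M"
    and bound: "\<And>n x. x \<in> space M \<Longrightarrow> \<bar>D n x\<bar> \<le> K / real (Suc n)"
    and orth: "\<And>i j. i < j \<Longrightarrow> expectation (\<lambda>x. D i x * D j x) = 0"
  shows "AE x in M. summable (\<lambda>n. D n x)"
proof -
  define I :: "nat \<Rightarrow> nat set" where "I k = {k ^ 3..<Suc k ^ 3}" for k
  define B where "B k x = (\<Sum>i\<in>I k. D i x)" for k x
  text \<open>
    The block from \<open>k\<^sup>3\<close> to \<open>(k + 1)\<^sup>3\<close> has variance \<open>O(k\<^sup>-\<^sup>4)\<close>, so \<open>\<bar>B k\<bar> \<le> k\<^sup>2 (B k)\<^sup>2 + k\<^sup>-\<^sup>2\<close> is
    summable, while the partial sums move by only \<open>O(1 / k)\<close> inside a block; this avoids a maximal inequality.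
  \<close>
  have K: "0 \<le> K"
    using bound[of _ 0] not_empty by fastforce
  have card_I: "real (card (I k)) \<le> 7 * real k ^ 2" if "0 < k" for k
  proof -
    have "real (card (I k)) = real (Suc k) ^ 3 - real k ^ 3"
      unfolding I_def by (simp add: of_nat_diff power_mono)
    also have "\<dots> = 3 * real k ^ 2 + 3 * real k + 1"
      by (simp add: power3_eq_cube power2_eq_square algebra_simps)
    also have "\<dots> \<le> 7 * real k ^ 2"
    proof -
      have "1 \<le> real k" using that by simp
      moreover from this have "real k \<le> real k ^ 2"
        by (rule self_le_power) simp
      ultimately show ?thesis by linarith
    qed
    finally show ?thesis .
  qed
  have on_block: "K / real (Suc i) \<le> K / real k ^ 3" if "i \<in> I k" "0 < k" for i k
  proof -
    have "k ^ 3 \<le> Suc i" using that by (auto simp: I_def)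
    then have "real k ^ 3 \<le> real (Suc i)" by (metis of_nat_le_iff of_nat_power)
    then show ?thesis using that K by (intro divide_left_mono) auto
  qed
  have B_meas[measurable]: "B k \<in> borel_measurable M" for k
    unfolding B_def by simp
  have B_bound: "\<bar>B k x\<bar> \<le> (\<Sum>i\<in>I k. K / real (Suc i))" if "x \<in> space M" for k x
    unfolding B_def using bound[OF that] by (intro order_trans[OF sum_abs] sum_mono) auto
  have B_int: "integrable M (\<lambda>x. (B k x)\<^sup>2)" for k
  proof (rule integrable_const_bound[of _ "(\<Sum>i\<in>I k. K / real (Suc i))\<^sup>2"])
    show "AE x in M. norm ((B k x)\<^sup>2) \<le> (\<Sum>i\<in>I k. K / real (Suc i))\<^sup>2"
    proof (rule AE_I2)
      fix x assume "x \<in> space M"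
      from power_mono[OF B_bound[OF this, of k], of 2]
      show "norm ((B k x)\<^sup>2) \<le> (\<Sum>i\<in>I k. K / real (Suc i))\<^sup>2"
        by simp
    qed
  qed simp
  have B_exp: "expectation (\<lambda>x. (B k x)\<^sup>2) \<le> 7 * K\<^sup>2 * inverse (real k ^ 4)" if "0 < k" for k
  proof -
    have "expectation (\<lambda>x. (B k x)\<^sup>2) \<le> (\<Sum>i\<in>I k. (K / real (Suc i))\<^sup>2)"
      unfolding B_def using bound orth
      by (intro expectation_square_sum_orthogonal) (auto simp: I_def)
    also have "\<dots> \<le> (\<Sum>i\<in>I k. (K / real k ^ 3)\<^sup>2)"
      using on_block that K by (intro sum_mono power_mono) auto
    also have "\<dots> \<le> (7 * real k ^ 2) * (K / real k ^ 3)\<^sup>2"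
      using card_I[OF that] by (simp add: mult_right_mono)
    also have "\<dots> = 7 * K\<^sup>2 * inverse (real k ^ 4)"
      using that by (simp add: field_simps power_numeral_reduce)
    finally show ?thesis .
  qed
  have inv_sq: "summable (\<lambda>k. inverse (real k ^ 2))"
    by (rule inverse_power_summable) simp
  have "AE x in M. summable (\<lambda>k. real k ^ 2 * (B k x)\<^sup>2)"
  proof (rule AE_summable_if_expectations_summable)
    show "summable (\<lambda>k. expectation (\<lambda>x. real k ^ 2 * (B k x)\<^sup>2))"
    proof (rule summable_comparison_test')
      show "summable (\<lambda>k. 7 * K\<^sup>2 * inverse (real k ^ 2))"
        by (intro summable_mult inv_sq)
      fix k :: nat assume k: "1 \<le> k"
      have "real k ^ 2 * expectation (\<lambda>x. (B k x)\<^sup>2) \<le> real k ^ 2 * (7 * K\<^sup>2 * inverse (real k ^ 4))"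
        using B_exp k by (intro mult_left_mono) auto
      also have "\<dots> = 7 * K\<^sup>2 * inverse (real k ^ 2)"
        using k by (simp add: field_simps power_numeral_reduce)
      finally show "norm (expectation (\<lambda>x. real k ^ 2 * (B k x)\<^sup>2)) \<le> 7 * K\<^sup>2 * inverse (real k ^ 2)"
        by simp
    qed
  qed (use B_int in auto)
  then show ?thesis
  proof (rule AE_mp, intro AE_I2 impI)
    fix x assume x: "x \<in> space M" and summ: "summable (\<lambda>k. real k ^ 2 * (B k x)\<^sup>2)"
    define Q where "Q n = (\<Sum>i<n. D i x)" for n
    have "summable (\<lambda>k. B k x)"
    proof (rule summable_comparison_test')
      show "summable (\<lambda>k. real k ^ 2 * (B k x)\<^sup>2 + inverse (real k ^ 2))"
        by (intro summable_add summ inv_sq)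
      fix k :: nat assume k: "1 \<le> k"
      have "0 \<le> (real k * \<bar>B k x\<bar> - inverse (real k))\<^sup>2" by simp
      also have "\<dots> = real k ^ 2 * (B k x)\<^sup>2 + inverse (real k ^ 2) - 2 * \<bar>B k x\<bar>"
        using k by (simp add: power2_diff power_mult_distrib power_inverse)
      finally show "norm (B k x) \<le> real k ^ 2 * (B k x)\<^sup>2 + inverse (real k ^ 2)"
        by simp
    qed
    moreover have Q_cube: "(\<Sum>k<n. B k x) = Q (n ^ 3)" for n
    proof (induction n)
      case (Suc n)
      have "Q (Suc n ^ 3) = Q (n ^ 3) + B n x"
        unfolding Q_def B_def I_def lessThan_atLeast0
        by (subst sum.atLeastLessThan_concat) (auto intro: power_mono)
      with Suc show ?case by simp
    qed (simp add: Q_def)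
    ultimately obtain L where L: "(\<lambda>n. Q (n ^ 3)) \<longlonglongrightarrow> L"
      unfolding summable_iff_convergent convergent_def by auto
    have "Q \<longlonglongrightarrow> L"
    proof (rule LIMSEQ_I)
      fix e :: real assume e: "0 < e"
      have "(\<lambda>k. 7 * K * inverse (real k)) \<longlonglongrightarrow> 7 * K * 0"
        by (intro tendsto_intros lim_inverse_n)
      then have "\<forall>\<^sub>F k in sequentially. 7 * K * inverse (real k) < e / 2"
        using e by (intro order_tendstoD(2)) auto
      moreover have "\<forall>\<^sub>F k in sequentially. dist (Q (k ^ 3)) L < e / 2"
        using e L by (intro tendstoD) auto
      ultimately have "\<forall>\<^sub>F k in sequentially. 7 * K * inverse (real k) < e / 2 \<and> dist (Q (k ^ 3)) L < e / 2"
        by (rule eventually_conj)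
      then obtain k1 where k1: "\<And>k. k1 \<le> k \<Longrightarrow> 7 * K * inverse (real k) < e / 2 \<and> dist (Q (k ^ 3)) L < e / 2"
        unfolding eventually_sequentially by auto
      show "\<exists>no. \<forall>n\<ge>no. norm (Q n - L) < e"
      proof (intro exI allI impI)
        fix n assume n: "Suc k1 ^ 3 \<le> n"
        obtain k where k: "Suc k1 \<le> k" "k ^ 3 \<le> n" "n < Suc k ^ 3"
          using cube_interval[OF n] .
        have "Q n = Q (k ^ 3) + (\<Sum>i\<in>{k^3..<n}. D i x)"
          unfolding Q_def lessThan_atLeast0 using k by (subst sum.atLeastLessThan_concat) auto
        then have "\<bar>Q n - Q (k ^ 3)\<bar> \<le> (\<Sum>i\<in>{k^3..<n}. \<bar>D i x\<bar>)"
          by simp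
        also have "\<dots> \<le> (\<Sum>i\<in>I k. \<bar>D i x\<bar>)"
          unfolding I_def using k by (intro sum_mono2) auto
        also have "\<dots> \<le> (\<Sum>i\<in>I k. K / real k ^ 3)"
          using k by (intro sum_mono order_trans[OF bound[OF x] on_block]) auto
        also have "\<dots> \<le> (7 * real k ^ 2) * (K / real k ^ 3)"
          using card_I[of k] k K by (simp add: divide_right_mono mult_right_mono)
        also have "\<dots> = 7 * K * inverse (real k)"
          using k by (simp add: field_simps power_numeral_reduce)
        finally have "\<bar>Q n - Q (k ^ 3)\<bar> < e / 2" "dist (Q (k ^ 3)) L < e / 2"
          using k1[of k] k by auto
        then show "norm (Q n - L) < e"
          unfolding dist_real_def real_norm_def by linarith
      qed
    qed
    then show "summable (\<lambda>n. D n x)"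
      unfolding summable_iff_convergent Q_def by (rule convergentI)
  qed
qed

end

section \<open>Sums over words and the concentration of unit-modulus means\<close>

definition words :: "'b set \<Rightarrow> nat \<Rightarrow> 'b list set" where
  "words A m = {xs. set xs \<subseteq> A \<and> length xs = m}"

text \<open>When the weights \<open>a\<close> are nonnegative and sum to 1, this is the expectation
  of \<open>F\<close> over \<open>m\<close> independent draws from \<open>a\<close>. Vector values
  are allowed so that complex characters and real events share one notion.\<close>

definition word_mean :: "'b set \<Rightarrow> ('b \<Rightarrow> real) \<Rightarrow> nat \<Rightarrow> ('b list \<Rightarrow> 'c :: real_vector) \<Rightarrow> 'c" where
  "word_mean A a m F = (\<Sum>xs\<in>words A m. prod_list (map a xs) *\<^sub>R F xs)"

lemma finite_words: "finite A \<Longrightarrow> finite (words A m)"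
  unfolding words_def by (rule finite_lists_length_eq)

lemma words_0: "words A 0 = {[]}"
  by (auto simp: words_def)

lemma words_Suc: "words A (Suc m) = (\<lambda>(x, xs). x # xs) ` (A \<times> words A m)"
  by (auto simp: words_def length_Suc_conv image_iff)

lemma word_mean_0: "word_mean A a 0 F = F []"
  by (simp add: word_mean_def words_0)

lemma word_mean_Suc:
  "word_mean A a (Suc m) F = (\<Sum>x\<in>A. a x *\<^sub>R word_mean A a m (\<lambda>xs. F (x # xs)))"
proof -
  have "word_mean A a (Suc m) F
      = (\<Sum>(x, xs)\<in>A \<times> words A m. prod_list (map a (x # xs)) *\<^sub>R F (x # xs))"
    unfolding word_mean_def words_Suc
    by (subst sum.reindex) (auto simp: inj_on_def case_prod_unfold)
  also have "\<dots> = (\<Sum>x\<in>A. \<Sum>xs\<in>words A m. prod_list (map a (x # xs)) *\<^sub>R F (x # xs))"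
    by (simp add: sum.cartesian_product)
  finally show ?thesis
    by (simp add: word_mean_def scaleR_sum_right)
qed

text \<open>Independence: the mean of a product over the draws is the product of the means. For a
  character this turns the mean over \<open>m\<close> draws into the \<open>m\<close>-th power of
  the Fourier coefficient.\<close>

lemma word_mean_prod_list:
  fixes u :: "'b \<Rightarrow> 'c :: real_algebra_1"
  shows "word_mean A a m (\<lambda>xs. prod_list (map u xs)) = (\<Sum>x\<in>A. a x *\<^sub>R u x) ^ m"
proof (induction m)
  case (Suc m)
  have "word_mean A a m (\<lambda>xs. v * prod_list (map u xs)) = v * word_mean A a m (\<lambda>xs. prod_list (map u xs))"
    for v
    by (simp add: word_mean_def sum_distrib_left)
  with Suc show ?case
    by (simp add: word_mean_Suc sum_distrib_right)
qed (simp add: word_mean_0)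

lemma word_mean_const: "word_mean A a m (\<lambda>_. 1 :: real) = (\<Sum>x\<in>A. a x) ^ m"
  using word_mean_prod_list[of A a m "\<lambda>_. 1 :: real"] by (simp add: map_replicate_const)

lemma word_mean_mono:
  fixes F G :: "'b list \<Rightarrow> real"
  assumes "\<And>x. x \<in> A \<Longrightarrow> 0 \<le> a x" and "\<And>xs. xs \<in> words A m \<Longrightarrow> F xs \<le> G xs"
  shows "word_mean A a m F \<le> word_mean A a m G"
  unfolding word_mean_def using assms
  by (intro sum_mono) (force simp: words_def intro!: mult_left_mono prod_list_nonneg)

lemma word_mean_diff:
  "word_mean A a m (\<lambda>xs. F xs - G xs) = word_mean A a m F - word_mean A a m G"
  by (simp add: word_mean_def scaleR_diff_right sum_subtractf)

lemma Re_word_mean: "Re (word_mean A a m F) = word_mean A a m (\<lambda>xs. Re (F xs))"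
  by (simp add: word_mean_def)

lemma Im_word_mean: "Im (word_mean A a m F) = word_mean A a m (\<lambda>xs. Im (F xs))"
  by (simp add: word_mean_def)

lemma sum_of_bool_split:
  fixes a :: "'b \<Rightarrow> real"
  assumes "finite A"
  shows "(\<Sum>x\<in>A. a x * of_bool (Q x)) = (\<Sum>x | x \<in> A \<and> Q x. a x)"
proof -
  have "(\<Sum>x\<in>A. a x * of_bool (Q x)) = (\<Sum>x\<in>A. if Q x then a x else 0)"
    by (intro sum.cong) auto
  also have "\<dots> = (\<Sum>x\<in>{x \<in> A. Q x}. a x)"
    using assms by (simp add: sum.inter_filter)
  finally show ?thesis by simp
qed

text \<open>
  If \<open>q m\<close> is the probability that \<open>m\<close> draws have product \<open>\<noteq> 1\<close> and \<open>y\<close> that of one draw \<open>\<noteq> 1\<close>,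
  then \<open>q (m + 1) \<ge> (1 - 2 y) q m + y\<close>, and this map is monotone and does not decrease
  below \<open>1 / 2\<close>.
\<close>

lemma word_mean_prod_neq_1:
  fixes u :: "'b \<Rightarrow> 'c :: field"
  assumes A: "finite A" and a: "\<And>x. x \<in> A \<Longrightarrow> 0 \<le> a x" and sum_a: "(\<Sum>x\<in>A. a x) = 1"
    and y_def: "y = (\<Sum>x | x \<in> A \<and> u x \<noteq> 1. a x)" and y: "y \<le> 1 / 2" and m: "2 \<le> m"
  shows "2 * y * (1 - y) \<le> word_mean A a m (\<lambda>xs. of_bool (prod_list (map u xs) \<noteq> 1))"
proof -
  define q :: "nat \<Rightarrow> real" where "q m = word_mean A a m (\<lambda>xs. of_bool (prod_list (map u xs) \<noteq> 1))" for m
  have y_sum: "(\<Sum>x\<in>A. a x * of_bool (u x \<noteq> 1)) = y"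
    using sum_of_bool_split[OF A] by (simp add: y_def)
  have step: "(1 - 2 * y) * q m + y \<le> q (Suc m)" for m
  proof -
    \<comment> \<open>The bracket below is \<open>q m\<close> if \<open>u x = 1\<close> and
      \<open>1 - q m\<close> otherwise. In the second case \<open>1 - q m\<close> is only a lower
      bound: a first factor different from 1 certainly spoils the product when the remaining factors
      multiply to 1.\<close>
    have "(1 - 2 * y) * q m + y
        = (\<Sum>x\<in>A. a x * (q m + of_bool (u x \<noteq> 1) * (1 - 2 * q m)))"
    proof -
      have "(\<Sum>x\<in>A. a x * (q m + of_bool (u x \<noteq> 1) * (1 - 2 * q m)))
          = (\<Sum>x\<in>A. a x) * q m + (\<Sum>x\<in>A. a x * of_bool (u x \<noteq> 1)) * (1 - 2 * q m)"
        unfolding sum_distrib_right sum.distrib[symmetric]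
        by (intro sum.cong) (auto simp: algebra_simps)
      then show ?thesis
        unfolding sum_a y_sum by (simp add: algebra_simps)
    qed
    also have "\<dots> \<le> (\<Sum>x\<in>A. a x * word_mean A a m (\<lambda>xs. of_bool (prod_list (map u (x # xs)) \<noteq> 1)))"
    proof (intro sum_mono mult_left_mono a)
      fix x
      show "q m + of_bool (u x \<noteq> 1) * (1 - 2 * q m)
          \<le> word_mean A a m (\<lambda>xs. of_bool (prod_list (map u (x # xs)) \<noteq> 1))"
      proof (cases "u x = 1")
        case False
        have "1 - q m = word_mean A a m (\<lambda>xs. 1 - of_bool (prod_list (map u xs) \<noteq> 1))"
          by (simp add: q_def word_mean_diff word_mean_const sum_a del: of_bool_not_iff)
        also have "\<dots> \<le> word_mean A a m (\<lambda>xs. of_bool (prod_list (map u (x # xs)) \<noteq> 1))"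
          using False a by (intro word_mean_mono) auto
        finally show ?thesis using False by simp
      qed (simp add: q_def)
    qed
    also have "\<dots> = q (Suc m)"
      by (simp add: q_def word_mean_Suc)
    finally show ?thesis .
  qed
  have q1: "q 1 = y"
    by (simp add: q_def word_mean_Suc word_mean_0 y_sum del: of_bool_not_iff)
  have y0: "0 \<le> y"
    unfolding y_def using a by (intro sum_nonneg) auto
  have "2 * y * (1 - y) \<le> q m"
    using m
  proof (induction m rule: dec_induct)
    case base
    show ?case
      using step[of 1] unfolding q1 by (simp add: q1 numeral_2_eq_2 algebra_simps)
  next
    case (step m)
    \<comment> \<open>The square is \<open>1 - 4 * y * (1 - y)\<close>, and \<open>y\<close> times
      it is exactly the amount by which the recursion raises the value
      \<open>2 * y * (1 - y)\<close>.\<close>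
    have "0 \<le> (1 - 2 * y)\<^sup>2" by simp
    then have "0 \<le> y * (1 - 4 * y * (1 - y))"
      using y0 by (intro mult_nonneg_nonneg) (auto simp: power2_eq_square algebra_simps)
    then have "2 * y * (1 - y) \<le> (1 - 2 * y) * (2 * y * (1 - y)) + y"
      by (simp add: algebra_simps)
    also have "\<dots> \<le> (1 - 2 * y) * q m + y"
      using step y by (intro add_right_mono mult_left_mono) auto
    also have "\<dots> \<le> q (Suc m)"
      by fact
    finally show ?case .
  qed
  then show ?thesis
    by (simp add: q_def)
qed

text \<open>If all \<open>m\<close> draws have value \<open>v\<close>, their product is
  \<open>v ^ m\<close>, which differs from \<open>v\<close>; the left-hand side is the probability
  of that single event.\<close>

lemma word_mean_prod_neq:
  fixes u :: "'b \<Rightarrow> 'c :: field"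
  assumes A: "finite A" and a: "\<And>x. x \<in> A \<Longrightarrow> 0 \<le> a x" and sum_a: "(\<Sum>x\<in>A. a x) = 1"
    and v: "v ^ m \<noteq> v"
  shows "(1 - (\<Sum>x | x \<in> A \<and> u x \<noteq> v. a x)) ^ m
    \<le> word_mean A a m (\<lambda>xs. of_bool (prod_list (map u xs) \<noteq> v))"
proof -
  have "(\<Sum>x\<in>A. a x * of_bool (u x = v)) = (\<Sum>x\<in>A. a x - a x * of_bool (u x \<noteq> v))"
    by (intro sum.cong) auto
  then have "(\<Sum>x\<in>A. a x * of_bool (u x = v)) = 1 - (\<Sum>x | x \<in> A \<and> u x \<noteq> v. a x)"
    using sum_of_bool_split[OF A, of a "\<lambda>x. u x \<noteq> v"] sum_a
    by (simp add: sum_subtractf del: of_bool_not_iff)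
  then have "(1 - (\<Sum>x | x \<in> A \<and> u x \<noteq> v. a x)) ^ m
      = word_mean A a m (\<lambda>xs. prod_list (map (\<lambda>x. of_bool (u x = v)) xs))"
    by (simp add: word_mean_prod_list)
  also have "\<dots> \<le> word_mean A a m (\<lambda>xs. of_bool (prod_list (map u xs) \<noteq> v))"
  proof (rule word_mean_mono[OF a])
    fix xs :: "'b list" assume xs: "xs \<in> words A m"
    have "prod_list (map (\<lambda>x. of_bool (u x = v)) xs) = (of_bool (\<forall>x\<in>set xs. u x = v) :: real)"
      by (induction xs) auto
    also have "\<dots> \<le> of_bool (prod_list (map u xs) \<noteq> v)"
    proof -
      have "prod_list (map u xs) = v ^ m" if "\<forall>x\<in>set xs. u x = v"
      proof -
        have "map u xs = replicate m v"
          using that xs by (auto simp: words_def intro: map_replicate_const[symmetric] replicate_eqI)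
        then show ?thesis by simp
      qed
      then show ?thesis using v by auto
    qed
    finally show "prod_list (map (\<lambda>x. of_bool (u x = v)) xs) \<le> (of_bool (prod_list (map u xs) \<noteq> v) :: real)" .
  qed
  finally show ?thesis .
qed

section \<open>Variance of unit-modulus variables and concentration on a level set\<close>

text \<open>Both sides are the variance of \<open>u\<close>: the second moment is 1, and a variance
  is half the mean squared distance of two independent copies.\<close>

lemma one_minus_norm_mean_squared:
  fixes u :: "'b \<Rightarrow> complex"
  assumes u: "\<And>x. x \<in> A \<Longrightarrow> norm (u x) = 1" and sum_a: "(\<Sum>x\<in>A. a x) = 1"
  shows "1 - (norm (\<Sum>x\<in>A. a x *\<^sub>R u x))\<^sup>2
    = (\<Sum>x\<in>A. \<Sum>x'\<in>A. a x * a x' * (norm (u x - u x'))\<^sup>2) / 2"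
proof -
  have unit: "(Re (u x))\<^sup>2 + (Im (u x))\<^sup>2 = 1" if "x \<in> A" for x
    using u[OF that] by (metis cmod_power2 one_power2)
  have "(norm (\<Sum>x\<in>A. a x *\<^sub>R u x))\<^sup>2
      = (\<Sum>x\<in>A. \<Sum>x'\<in>A. a x * a x' * (Re (u x) * Re (u x') + Im (u x) * Im (u x')))"
    unfolding cmod_power2
    unfolding Re_sum Im_sum power2_eq_square sum_product
    by (simp add: sum.distrib[symmetric] algebra_simps)
  moreover have "1 = (\<Sum>x\<in>A. \<Sum>x'\<in>A. a x * a x')"
    using sum_product[of a A a A] sum_a by simp
  ultimately have "1 - (norm (\<Sum>x\<in>A. a x *\<^sub>R u x))\<^sup>2
      = (\<Sum>x\<in>A. \<Sum>x'\<in>A. a x * a x' * (1 - (Re (u x) * Re (u x') + Im (u x) * Im (u x'))))"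
    by (simp add: sum_subtractf right_diff_distrib)
  also have "\<dots> = (\<Sum>x\<in>A. \<Sum>x'\<in>A. a x * a x' * (norm (u x - u x'))\<^sup>2 / 2)"
  proof (intro sum.cong refl)
    fix x x' assume "x \<in> A" "x' \<in> A"
    then have "1 - (Re (u x) * Re (u x') + Im (u x) * Im (u x')) = (norm (u x - u x'))\<^sup>2 / 2"
      using unit[of x] unit[of x'] unfolding cmod_power2
      by (simp add: power2_eq_square algebra_simps)
    then show "a x * a x' * (1 - (Re (u x) * Re (u x') + Im (u x) * Im (u x')))
        = a x * a x' * (norm (u x - u x'))\<^sup>2 / 2"
      by simp
  qed
  finally show ?thesis
    by (simp add: sum_divide_distrib)
qed

text \<open>Some \<open>x0\<close> has weight at least \<open>1 / card A\<close> by pigeonhole. In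
  the double sum for the variance only the row of \<open>x0\<close> is kept, where each point off
  its level set contributes at least \<open>\<gamma>\<close> times its weight.\<close>

lemma concentrated_if_norm_mean_near_1:
  fixes u :: "'b \<Rightarrow> complex"
  assumes A: "finite A" "A \<noteq> {}" and a: "\<And>x. x \<in> A \<Longrightarrow> 0 \<le> a x" and sum_a: "(\<Sum>x\<in>A. a x) = 1"
    and u: "\<And>x. x \<in> A \<Longrightarrow> norm (u x) = 1"
    and gap: "\<And>x x'. x \<in> A \<Longrightarrow> x' \<in> A \<Longrightarrow> u x \<noteq> u x' \<Longrightarrow> \<gamma> \<le> (norm (u x - u x'))\<^sup>2"
  shows "\<exists>x0\<in>A. \<gamma> * (\<Sum>x | x \<in> A \<and> u x \<noteq> u x0. a x)
    \<le> 2 * real (card A) * (1 - (norm (\<Sum>x\<in>A. a x *\<^sub>R u x))\<^sup>2)"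
proof -
  have "\<exists>x0\<in>A. 1 / real (card A) \<le> a x0"
  proof (rule ccontr)
    assume "\<not> ?thesis"
    then have "(\<Sum>x\<in>A. a x) < (\<Sum>x\<in>A. 1 / real (card A))"
      using A by (intro sum_strict_mono) auto
    then show False using A sum_a by simp
  qed
  then obtain x0 where x0: "x0 \<in> A" "1 / real (card A) \<le> a x0" by blast
  have card_pos: "0 < real (card A)" using A by (simp add: card_gt_0_iff)
  have rest: "(\<Sum>x | x \<in> A \<and> u x \<noteq> u x0. a x) = (\<Sum>x\<in>A. a x * of_bool (u x \<noteq> u x0))"
    using sum_of_bool_split[OF A(1), of a "\<lambda>x. u x \<noteq> u x0"] by simp
  let ?S = "\<Sum>x'\<in>A. a x' * (norm (u x0 - u x'))\<^sup>2"
  have S: "\<gamma> * (\<Sum>x | x \<in> A \<and> u x \<noteq> u x0. a x) \<le> ?S"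
    unfolding rest sum_distrib_left
  proof (rule sum_mono)
    fix x assume x: "x \<in> A"
    show "\<gamma> * (a x * of_bool (u x \<noteq> u x0)) \<le> a x * (norm (u x0 - u x))\<^sup>2"
      using mult_left_mono[OF gap[OF x0(1) x] a[OF x]] by (cases "u x = u x0") (auto simp: mult.commute)
  qed
  have "1 / real (card A) * ?S \<le> a x0 * ?S"
    using x0 a by (intro mult_right_mono sum_nonneg) auto
  also have "\<dots> = (\<Sum>x'\<in>A. a x0 * a x' * (norm (u x0 - u x'))\<^sup>2)"
    by (simp add: sum_distrib_left mult.assoc)
  also have "\<dots> \<le> (\<Sum>x\<in>A. \<Sum>x'\<in>A. a x * a x' * (norm (u x - u x'))\<^sup>2)"
    using A x0 a by (intro member_le_sum[where f = "\<lambda>x. \<Sum>x'\<in>A. a x * a x' * (norm (u x - u x'))\<^sup>2"])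
      (auto intro!: sum_nonneg)
  also have "\<dots> = 2 * (1 - (norm (\<Sum>x\<in>A. a x *\<^sub>R u x))\<^sup>2)"
    by (subst one_minus_norm_mean_squared[OF u sum_a]) simp_all
  finally have "?S \<le> real (card A) * (2 * (1 - (norm (\<Sum>x\<in>A. a x *\<^sub>R u x))\<^sup>2))"
    using card_pos by (simp add: field_simps)
  with S x0(1) show ?thesis
    by (intro bexI[of _ x0]) (auto simp: algebra_simps)
qed

section \<open>The urn process\<close>

text \<open>The draw-size law is given by its finite support \<open>Ms\<close> and a mass function
  \<open>p\<close> on sizes, so that means over sizes become sums over \<open>Ms\<close>.\<close>

locale mau = prob_space P for P :: "'a measure" +
  fixes d :: nat and S0 :: "int \<Rightarrow> nat" and X :: "nat \<Rightarrow> 'a \<Rightarrow> int list"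
    and Ms :: "nat set" and p :: "nat \<Rightarrow> real"
  assumes d: "2 \<le> d"
    and start: "valid_start d S0"
    and draws: "draw_sequence P d X"
    and cond_law: "assumption_1 P d S0 X"
    and Ms: "finite Ms" "\<And>m. m \<in> Ms \<Longrightarrow> 2 \<le> m"
    and p: "\<And>m. m \<in> Ms \<Longrightarrow> 0 < p m" "(\<Sum>m\<in>Ms. p m) = 1"
    and draw_size_law: "\<And>i m. 1 \<le> i \<Longrightarrow> m \<in> Ms \<Longrightarrow> prob {\<omega> \<in> space P. draw_size X i \<omega> = m} = p m"
    and coprime_size: "\<exists>m\<in>Ms. coprime (m - 1) d"
begin

abbreviation "labels \<equiv> carrier (integer_mod_group d)"
abbreviation "F n \<equiv> draw_history P X n"
abbreviation "fraction n j \<omega> \<equiv> ball_fraction d S0 X n j \<omega>"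

definition N :: "nat \<Rightarrow> real" where "N n = real (n + initial_balls d S0)"

text \<open>With \<open>a\<close> the current composition of the urn, this is the conditional
  expectation, given the past, of \<open>f\<close> applied to the next tuple of draws.\<close>

definition next_mean :: "(int \<Rightarrow> real) \<Rightarrow> (int list \<Rightarrow> 'c) \<Rightarrow> 'c :: real_vector" where
  "next_mean a f = (\<Sum>m\<in>Ms. p m *\<^sub>R word_mean labels a m f)"

lemma labels_eq: "labels = {0..<int d}"
  using d by (simp add: carrier_integer_mod_group)

lemma finite_labels: "finite labels"
  by (simp add: labels_eq)

lemma N_pos: "1 \<le> N n"
  using start by (simp add: N_def valid_start_def)

lemma N_Suc: "N (Suc n) = N n + 1"
  by (simp add: N_def)

lemma N_gt: "real n < N n"
  using start by (simp add: N_def valid_start_def)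

lemma new_label_in: "new_label d X i \<omega> \<in> labels"
  using d by (simp add: labels_eq new_label_def)

lemma fraction_eq: "fraction n j \<omega> = real (ball_count d S0 X n j \<omega>) / N n"
  by (simp add: ball_fraction_def N_def)

lemma fraction_nonneg: "0 \<le> fraction n j \<omega>"
  by (simp add: ball_fraction_def)

lemma sum_ball_count: "(\<Sum>j\<in>labels. ball_count d S0 X n j \<omega>) = n + initial_balls d S0"
proof -
  have "(\<Sum>j\<in>labels. \<Sum>i=1..n. of_bool (new_label d X i \<omega> = j)) = n"
    using new_label_in finite_labels by (subst sum.swap) (simp add: of_bool_def)
  then show ?thesis
    by (simp add: ball_count_def sum.distrib initial_balls_def)
qed

lemma sum_fraction: "(\<Sum>j\<in>labels. fraction n j \<omega>) = 1"
proof -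
  have "(\<Sum>j\<in>labels. fraction n j \<omega>) = real (\<Sum>j\<in>labels. ball_count d S0 X n j \<omega>) / N n"
    by (simp add: fraction_eq sum_divide_distrib)
  then show ?thesis
    using N_pos[of n] unfolding sum_ball_count by (simp add: N_def)
qed

lemma ball_count_Suc:
  "ball_count d S0 X (Suc n) j \<omega> = ball_count d S0 X n j \<omega> + of_bool (new_label d X (Suc n) \<omega> = j)"
  by (simp add: ball_count_def)

lemma measurable_draw_history: "i \<in> {1..n} \<Longrightarrow> X i \<in> F n \<rightarrow>\<^sub>M count_space UNIV"
proof (rule measurableI)
  fix A :: "int list set"
  assume i: "i \<in> {1..n}"
  have gen: "{X i -` A \<inter> space P | i A. i \<in> {1..n}} \<subseteq> Pow (space P)"
    by blast
  show "X i -` A \<inter> space (F n) \<in> sets (F n)"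
    unfolding draw_history_def space_measure_of[OF gen] sets_measure_of[OF gen]
    using i by (intro sigma_sets.Basic) blast
qed simp

lemma subalgebra_F: "subalgebra P (F n)"
  using draws by (rule subalgebra_draw_history)

lemma measurable_F_imp: "f \<in> F n \<rightarrow>\<^sub>M M \<Longrightarrow> f \<in> P \<rightarrow>\<^sub>M M"
  using measurable_from_subalg[OF subalgebra_F] .

lemma measurable_draw: "1 \<le> i \<Longrightarrow> X i \<in> P \<rightarrow>\<^sub>M count_space UNIV"
  using measurable_F_imp[OF measurable_draw_history[of i i]] by simp

lemma measurable_draw_function: "i \<in> {1..n} \<Longrightarrow> (\<lambda>\<omega>. f (X i \<omega>)) \<in> F n \<rightarrow>\<^sub>M borel"
  by (rule measurable_compose[OF measurable_draw_history]) auto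

lemma measurable_count: "i \<le> n \<Longrightarrow> (\<lambda>\<omega>. real (ball_count d S0 X i j \<omega>)) \<in> borel_measurable (F n)"
  unfolding ball_count_def new_label_def of_nat_add of_nat_sum
  by (intro borel_measurable_add borel_measurable_sum borel_measurable_const measurable_draw_function) auto

lemma measurable_fraction: "i \<le> n \<Longrightarrow> (\<lambda>\<omega>. fraction i j \<omega>) \<in> borel_measurable (F n)"
  unfolding fraction_eq by (intro borel_measurable_divide measurable_count) auto

section \<open>The law of the next draw in integrated form\<close>

text \<open>The sizes in \<open>Ms\<close> have total probability 1. The next draw thus takes almost
  surely only finitely many values, and its conditional law reduces to finite sums.\<close>

lemma AE_draw_in:
  assumes "1 \<le> i"
  shows "AE \<omega> in P. X i \<omega> \<in> (\<Union>m\<in>Ms. words labels m)"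
proof -
  note [measurable] = measurable_draw[OF assms]
  have sets: "{\<omega> \<in> space P. draw_size X i \<omega> = m} \<in> events" for m
    unfolding draw_size_def by measurable
  have "prob (\<Union>m\<in>Ms. {\<omega> \<in> space P. draw_size X i \<omega> = m}) = (\<Sum>m\<in>Ms. prob {\<omega> \<in> space P. draw_size X i \<omega> = m})"
    using sets by (intro finite_measure_finite_Union Ms) (auto simp: disjoint_family_on_def)
  also have "\<dots> = 1"
    using draw_size_law[OF assms] p by simp
  finally have "AE \<omega> in P. \<omega> \<in> (\<Union>m\<in>Ms. {\<omega> \<in> space P. draw_size X i \<omega> = m})"
    by (rule AE_prob_1)
  moreover have "X i \<in> P \<rightarrow>\<^sub>M count_space (lists labels)"
    using draws assms by (simp add: draw_sequence_def)
  then have "AE \<omega> in P. X i \<omega> \<in> lists labels"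
    by (intro AE_I2) (metis measurable_space space_count_space)
  ultimately show ?thesis
    by eventually_elim (auto simp: words_def draw_size_def)
qed

text \<open>Assumption 1 tested against a bounded function \<open>\<phi>\<close> of the past. All
  later arguments use this form, so conditional expectations appear only in this proof.\<close>

lemma expectation_next:
  fixes f :: "int list \<Rightarrow> real"
  assumes \<phi>: "\<phi> \<in> borel_measurable (F n)" and bound: "\<And>\<omega>. \<omega> \<in> space P \<Longrightarrow> \<bar>\<phi> \<omega>\<bar> \<le> K"
  shows "expectation (\<lambda>\<omega>. \<phi> \<omega> * f (X (Suc n) \<omega>))
    = expectation (\<lambda>\<omega>. \<phi> \<omega> * next_mean (\<lambda>j. fraction n j \<omega>) f)"
proof -
  let ?W = "\<Union>m\<in>Ms. words labels m"
  let ?I = "\<lambda>xs. indicator {\<omega> \<in> space P. X (Suc n) \<omega> = xs} :: 'a \<Rightarrow> real"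
  let ?\<Pi> = "\<lambda>xs \<omega>. prod_list (map (\<lambda>j. fraction n j \<omega>) xs)"
  note [measurable] = measurable_draw[of "Suc n", simplified] measurable_F_imp[OF \<phi>]
    measurable_F_imp[OF measurable_fraction[of n n, OF order_refl]]
  interpret sigma_finite_subalgebra P "F n"
    using subalgebra_F by (intro finite_measure_subalgebra_is_sigma_finite)
      (simp add: finite_measure_subalgebra_def finite_measure_subalgebra_axioms_def finite_measure_axioms)
  have fin: "finite ?W"
    using Ms finite_words[OF finite_labels] by auto
  have int: "integrable P (\<lambda>\<omega>. \<phi> \<omega> * ?I xs \<omega>)" for xs
  proof (rule integrable_const_bound[of _ K])
    show "AE \<omega> in P. norm (\<phi> \<omega> * ?I xs \<omega>) \<le> K"
      using bound by (intro AE_I2) (auto simp: indicator_def intro: order_trans[OF abs_ge_zero])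
  qed measurable
  have frac_le: "fraction n j \<omega> \<le> 1" if "j \<in> labels" for j \<omega>
    using member_le_sum[OF that, of "\<lambda>j. fraction n j \<omega>"] fraction_nonneg finite_labels
    by (simp add: sum_fraction)
  have \<Pi>_bounds: "0 \<le> ?\<Pi> xs \<omega> \<and> ?\<Pi> xs \<omega> \<le> 1" if "set xs \<subseteq> labels" for xs \<omega>
    using that by (induction xs) (auto simp: fraction_nonneg frac_le intro!: mult_le_one)
  have \<Pi>_meas: "?\<Pi> xs \<in> borel_measurable P" for xs
    by (induction xs) (auto intro!: borel_measurable_times)
  have int\<Pi>: "integrable P (\<lambda>\<omega>. \<phi> \<omega> * ?\<Pi> xs \<omega>)" if "set xs \<subseteq> labels" for xs
  proof (rule integrable_const_bound[of _ K])
    show "AE \<omega> in P. norm (\<phi> \<omega> * ?\<Pi> xs \<omega>) \<le> K"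
    proof (rule AE_I2)
      fix \<omega> assume "\<omega> \<in> space P"
      then show "norm (\<phi> \<omega> * ?\<Pi> xs \<omega>) \<le> K"
        using \<Pi>_bounds[OF that, of \<omega>] bound[of \<omega>] mult_mono[of "\<bar>\<phi> \<omega>\<bar>" K "\<bar>?\<Pi> xs \<omega>\<bar>" 1]
        by (simp add: abs_mult)
    qed
  qed (use \<Pi>_meas in auto)
  have one: "expectation (\<lambda>\<omega>. \<phi> \<omega> * ?I xs \<omega>) = p m * expectation (\<lambda>\<omega>. \<phi> \<omega> * ?\<Pi> xs \<omega>)"
    if "m \<in> Ms" "xs \<in> words labels m" for m xs
  proof -
    have xs: "xs \<in> lists labels" "length xs = m"
      using that by (auto simp: words_def)
    \<comment> \<open>Stage \<open>Suc n\<close> is conditioned on the history up to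
      \<open>Suc n - 1 = n\<close>; the positivity premise of the assumption is
      \<open>0 < p m\<close>.\<close>
    have "AE \<omega> in P. real_cond_exp P (F n) (?I xs) \<omega> = p m * (\<Prod>l<m. fraction n (xs ! l) \<omega>)"
      using cond_law[unfolded assumption_1_def, rule_format, of "Suc n" m xs] xs p(1)[OF that(1)]
      by (simp add: draw_size_law that(1))
    moreover have "(\<Prod>l<m. fraction n (xs ! l) \<omega>) = ?\<Pi> xs \<omega>" for \<omega>
      using xs by (simp add: prod.list_conv_set_nth atLeast0LessThan)
    ultimately have cond: "AE \<omega> in P. real_cond_exp P (F n) (?I xs) \<omega> = p m * ?\<Pi> xs \<omega>"
      by simp
    have "expectation (\<lambda>\<omega>. \<phi> \<omega> * ?I xs \<omega>) = expectation (\<lambda>\<omega>. \<phi> \<omega> * real_cond_exp P (F n) (?I xs) \<omega>)"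
      using int \<phi> by (intro real_cond_exp_intg(2)[symmetric]) auto
    also have "\<dots> = expectation (\<lambda>\<omega>. p m * (\<phi> \<omega> * ?\<Pi> xs \<omega>))"
      using cond by (intro integral_cong_AE) (auto intro!: borel_measurable_times \<Pi>_meas borel_measurable_cond_exp2)
    finally show ?thesis by simp
  qed
  \<comment> \<open>Almost surely \<open>f\<close> of the draw is a finite combination of indicators
    of single words, to which \<open>one\<close> applies term by term.\<close>
  have "expectation (\<lambda>\<omega>. \<phi> \<omega> * f (X (Suc n) \<omega>)) = expectation (\<lambda>\<omega>. \<Sum>xs\<in>?W. f xs * (\<phi> \<omega> * ?I xs \<omega>))"
  proof (rule integral_cong_AE)
    show "AE \<omega> in P. \<phi> \<omega> * f (X (Suc n) \<omega>) = (\<Sum>xs\<in>?W. f xs * (\<phi> \<omega> * ?I xs \<omega>))"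
      using AE_draw_in[OF le_add1[of 1 n, unfolded plus_1_eq_Suc]] AE_space
    proof eventually_elim
      case (elim \<omega>)
      have "(\<Sum>xs\<in>?W. f xs * (\<phi> \<omega> * ?I xs \<omega>)) = (\<Sum>xs\<in>?W. if xs = X (Suc n) \<omega> then f xs * \<phi> \<omega> else 0)"
        using elim by (intro sum.cong) (auto simp: indicator_def)
      then show ?case
        using elim fin by simp
    qed
  qed measurable
  also have "\<dots> = (\<Sum>xs\<in>?W. f xs * expectation (\<lambda>\<omega>. \<phi> \<omega> * ?I xs \<omega>))"
    using int by simp
  also have "\<dots> = (\<Sum>m\<in>Ms. \<Sum>xs\<in>words labels m. f xs * expectation (\<lambda>\<omega>. \<phi> \<omega> * ?I xs \<omega>))"
    using Ms finite_words[OF finite_labels] by (intro sum.UNION_disjoint) (auto simp: words_def)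
  also have "\<dots> = (\<Sum>m\<in>Ms. \<Sum>xs\<in>words labels m. expectation (\<lambda>\<omega>. f xs * p m * (\<phi> \<omega> * ?\<Pi> xs \<omega>)))"
    by (intro sum.cong refl) (simp add: one)
  also have "\<dots> = expectation (\<lambda>\<omega>. \<Sum>m\<in>Ms. \<Sum>xs\<in>words labels m. f xs * p m * (\<phi> \<omega> * ?\<Pi> xs \<omega>))"
  proof -
    have word: "integrable P (\<lambda>\<omega>. f xs * p m * (\<phi> \<omega> * ?\<Pi> xs \<omega>))" if "xs \<in> words labels m" for m xs
      using that by (intro integrable_mult_right int\<Pi>) (simp add: words_def)
    have inner: "(\<Sum>xs\<in>words labels m. expectation (\<lambda>\<omega>. f xs * p m * (\<phi> \<omega> * ?\<Pi> xs \<omega>)))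
        = expectation (\<lambda>\<omega>. \<Sum>xs\<in>words labels m. f xs * p m * (\<phi> \<omega> * ?\<Pi> xs \<omega>))" for m
      using word by (rule Bochner_Integration.integral_sum[symmetric])
    show ?thesis
      unfolding inner
      by (intro Bochner_Integration.integral_sum[symmetric] Bochner_Integration.integrable_sum word)
  qed
  also have "\<dots> = expectation (\<lambda>\<omega>. \<phi> \<omega> * next_mean (\<lambda>j. fraction n j \<omega>) f)"
    by (intro Bochner_Integration.integral_cong)
      (auto simp: next_mean_def word_mean_def sum_distrib_left mult_ac)
  finally show ?thesis .
qed

end

context mau
begin

lemma measurable_next_mean:
  fixes f :: "int list \<Rightarrow> real"
  assumes "i \<le> n"
  shows "(\<lambda>\<omega>. next_mean (\<lambda>j. fraction i j \<omega>) f) \<in> borel_measurable (F n)"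
proof -
  have "(\<lambda>\<omega>. prod_list (map (\<lambda>j. fraction i j \<omega>) xs)) \<in> borel_measurable (F n)" for xs
    by (induction xs) (auto intro!: borel_measurable_times measurable_fraction[OF assms])
  then show ?thesis
    unfolding next_mean_def word_mean_def real_scaleR_def
    by (intro borel_measurable_sum borel_measurable_times borel_measurable_const)
qed

lemma next_mean_mono:
  fixes f g :: "int list \<Rightarrow> real"
  assumes "\<And>xs. f xs \<le> g xs"
  shows "next_mean (\<lambda>j. fraction n j \<omega>) f \<le> next_mean (\<lambda>j. fraction n j \<omega>) g"
  unfolding next_mean_def real_scaleR_def using assms p(1)
  by (intro sum_mono mult_left_mono word_mean_mono) (auto simp: fraction_nonneg less_imp_le)

lemma next_mean_const: "next_mean (\<lambda>j. fraction n j \<omega>) (\<lambda>_. c :: real) = c"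
proof -
  have "word_mean A a m (\<lambda>_. c) = c * word_mean A a m (\<lambda>_. 1)" for A :: "int set" and a m
    by (simp add: word_mean_def sum_distrib_left mult.commute)
  then have "next_mean (\<lambda>j. fraction n j \<omega>) (\<lambda>_. c) = (\<Sum>m\<in>Ms. p m * c)"
    by (simp add: next_mean_def word_mean_const sum_fraction)
  then show ?thesis
    by (simp add: sum_distrib_right[symmetric] p)
qed

lemma next_mean_bound:
  fixes f :: "int list \<Rightarrow> real"
  assumes "\<And>xs. \<bar>f xs\<bar> \<le> 1"
  shows "\<bar>next_mean (\<lambda>j. fraction n j \<omega>) f\<bar> \<le> 1"
proof -
  have "f xs \<le> 1" "-1 \<le> f xs" for xs
    using assms[of xs] by auto
  then show ?thesis
    using next_mean_mono[of f "\<lambda>_. 1" n \<omega>] next_mean_mono[of "\<lambda>_. -1" f n \<omega>]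
    by (simp add: next_mean_const abs_le_iff)
qed

lemma integrable_F:
  fixes \<phi> :: "'a \<Rightarrow> real"
  assumes "\<phi> \<in> borel_measurable (F n)" and "\<And>\<omega>. \<omega> \<in> space P \<Longrightarrow> \<bar>\<phi> \<omega>\<bar> \<le> K"
  shows "integrable P \<phi>"
  using assms by (intro integrable_const_bound[of _ K] measurable_F_imp) auto

text \<open>The martingale difference property: the centred next value is orthogonal to every
  bounded function of the past.\<close>

lemma expectation_centred_next:
  fixes f :: "int list \<Rightarrow> real"
  assumes \<phi>: "\<phi> \<in> borel_measurable (F n)" and bound: "\<And>\<omega>. \<omega> \<in> space P \<Longrightarrow> \<bar>\<phi> \<omega>\<bar> \<le> K"
    and f: "\<And>xs. \<bar>f xs\<bar> \<le> 1"
  shows "integrable P (\<lambda>\<omega>. \<phi> \<omega> * (f (X (Suc n) \<omega>) - next_mean (\<lambda>j. fraction n j \<omega>) f))"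
    and "expectation (\<lambda>\<omega>. \<phi> \<omega> * (f (X (Suc n) \<omega>) - next_mean (\<lambda>j. fraction n j \<omega>) f)) = 0"
proof -
  have prod_bound: "\<bar>\<phi> \<omega> * x\<bar> \<le> K" if "\<omega> \<in> space P" "\<bar>x\<bar> \<le> 1" for \<omega> x
    using mult_mono[OF bound[OF that(1)] that(2)] bound[OF that(1)] by (simp add: abs_mult)
  have i1: "integrable P (\<lambda>\<omega>. \<phi> \<omega> * f (X (Suc n) \<omega>))"
    using prod_bound f measurable_F_imp[OF \<phi>] measurable_F_imp[OF measurable_draw_function[of "Suc n" "Suc n" f]]
    by (intro integrable_const_bound[of _ K] borel_measurable_times) auto
  have i2: "integrable P (\<lambda>\<omega>. \<phi> \<omega> * next_mean (\<lambda>j. fraction n j \<omega>) f)"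
    using prod_bound next_mean_bound[OF f] \<phi> measurable_next_mean[of n n f]
    by (intro integrable_F[of _ n K] borel_measurable_times) auto
  show "integrable P (\<lambda>\<omega>. \<phi> \<omega> * (f (X (Suc n) \<omega>) - next_mean (\<lambda>j. fraction n j \<omega>) f))"
    and "expectation (\<lambda>\<omega>. \<phi> \<omega> * (f (X (Suc n) \<omega>) - next_mean (\<lambda>j. fraction n j \<omega>) f)) = 0"
    using i1 i2 expectation_next[OF \<phi> bound, of f] by (simp_all add: right_diff_distrib)
qed

section \<open>Persistent concentration has probability zero\<close>

lemma AE_escapes:
  fixes T :: "nat \<Rightarrow> 'a \<Rightarrow> real" and B :: "int list \<Rightarrow> bool"
  assumes T_meas: "\<And>i n. i \<le> n \<Longrightarrow> T i \<in> borel_measurable (F n)"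
    and T_ge_1: "\<And>n \<omega>. 1 \<le> T n \<omega>"
    and T_Suc: "\<And>n \<omega>. T (Suc n) \<omega> = T n \<omega> + of_bool (B (X (Suc n) \<omega>))"
    and drift: "\<And>n \<omega>. n0 \<le> n \<Longrightarrow> T n \<omega> \<le> \<eta> * N n \<Longrightarrow>
      7 / 4 * T n \<omega> / N n \<le> next_mean (\<lambda>j. fraction n j \<omega>) (\<lambda>xs. of_bool (B xs))"
    and \<eta>: "\<eta> \<le> 1"
  shows "AE \<omega> in P. \<not> (\<forall>n\<ge>n0. T n \<omega> \<le> \<eta> * N n)"
proof -
  text \<open>The shift \<open>1 / 2\<close> in \<open>V\<close> makes the contraction work down to \<open>T = 1\<close>: \<open>T / (T + 1 / 2) \<ge> 2 / 3\<close>.\<close>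
  define A where "A n \<omega> = (of_bool (\<forall>i\<in>{n0..n}. T i \<omega> \<le> \<eta> * N i) :: real)" for n \<omega>
  define V where "V n \<omega> = N n / (T n \<omega> - 1 / 2)" for n \<omega>
  define e where "e k = expectation (\<lambda>\<omega>. A (n0 + k) \<omega> * V (n0 + k) \<omega>)" for k
  let ?b = "\<lambda>xs. of_bool (B xs) :: real"
  let ?q = "\<lambda>n \<omega>. next_mean (\<lambda>j. fraction n j \<omega>) ?b"
  have A_meas: "A n \<in> borel_measurable (F n)" for n
  proof -
    have "Measurable.pred (F n) (\<lambda>\<omega>. T i \<omega> \<le> \<eta> * N i)" if "i \<in> {n0..n}" for i
      unfolding pred_def using T_meas that by (intro borel_measurable_le) auto
    then have "Measurable.pred (F n) (\<lambda>\<omega>. \<forall>i\<in>{n0..n}. T i \<omega> \<le> \<eta> * N i)"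
      by (intro pred_intros_finite) auto
    then show ?thesis
      unfolding A_def of_bool_def by measurable
  qed
  have A_bounds: "0 \<le> A n \<omega>" "A n \<omega> \<le> 1" for n \<omega>
    by (simp_all add: A_def)
  have T_half: "1 / 2 \<le> T n \<omega> - 1 / 2" "1 \<le> T n \<omega> + 1 / 2" for n \<omega>
    using T_ge_1[of n \<omega>] by auto
  have inv_bounds: "0 \<le> 1 / (T n \<omega> - 1 / 2)" "1 / (T n \<omega> - 1 / 2) \<le> 2" for n \<omega>
    using T_half[of n \<omega>] by (auto simp: field_simps)
  have AV_bound: "\<bar>A n \<omega> * (c / (T n \<omega> - 1 / 2))\<bar> \<le> c * 2" if "0 \<le> c" for n \<omega> c
  proof -
    have "A n \<omega> * (c / (T n \<omega> - 1 / 2)) = A n \<omega> * (c * (1 / (T n \<omega> - 1 / 2)))" by simp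
    moreover have "\<dots> \<le> 1 * (c * 2)"
      using A_bounds[of n \<omega>] inv_bounds[of n \<omega>] that by (intro mult_mono) auto
    moreover have "0 \<le> A n \<omega> * (c * (1 / (T n \<omega> - 1 / 2)))"
      using A_bounds[of n \<omega>] inv_bounds[of n \<omega>] that by (intro mult_nonneg_nonneg) auto
    ultimately show ?thesis by linarith
  qed
  have AV_int: "integrable P (\<lambda>\<omega>. A n \<omega> * (c / (T n \<omega> - 1 / 2)))" if "0 \<le> c" for n c
    using AV_bound[OF that] T_meas[of n n] A_meas[of n] by (intro integrable_F[of _ n "c * 2"]) auto
  have V_pos: "0 \<le> V n \<omega>" for n \<omega>
    using T_half[of n \<omega>] N_pos[of n] by (simp add: V_def)
  have step: "expectation (\<lambda>\<omega>. A (Suc n) \<omega> * V (Suc n) \<omega>)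
      \<le> (1 - 1 / (6 * N n)) * expectation (\<lambda>\<omega>. A n \<omega> * V n \<omega>)" if n: "n0 \<le> n" for n
  proof -
    define g where "g \<omega> = A n \<omega> * (N (Suc n) / (T n \<omega> - 1 / 2))" for \<omega>
    define h where "h \<omega> = g \<omega> / (T n \<omega> + 1 / 2)" for \<omega>
    have N: "1 \<le> N n" "N (Suc n) = N n + 1"
      using N_pos N_Suc by auto
    have g_int: "integrable P g"
      unfolding g_def using N by (intro AV_int) auto
    have h_meas: "h \<in> borel_measurable (F n)"
      unfolding h_def g_def using T_meas[of n n] A_meas[of n] by auto
    have h_bound: "\<bar>h \<omega>\<bar> \<le> N (Suc n) * 2" for \<omega>
    proof -
      have "\<bar>h \<omega>\<bar> = \<bar>g \<omega>\<bar> / (T n \<omega> + 1 / 2)"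
        using T_half[of n \<omega>] by (simp add: h_def)
      also have "\<dots> \<le> \<bar>g \<omega>\<bar> / 1"
        using T_half[of n \<omega>] by (intro divide_left_mono) auto
      finally show ?thesis
        using AV_bound[of "N (Suc n)" n \<omega>] N unfolding g_def by simp
    qed
    have "\<bar>?b xs\<bar> \<le> 1" for xs by simp
    note centred = expectation_centred_next[OF h_meas h_bound this]
    have q_int: "integrable P (\<lambda>\<omega>. h \<omega> * ?q n \<omega>)"
    proof (rule integrable_F[of _ n])
      show "\<bar>h \<omega> * ?q n \<omega>\<bar> \<le> N (Suc n) * 2 * 1" for \<omega>
        unfolding abs_mult using N by (intro mult_mono h_bound next_mean_bound) auto
    qed (intro borel_measurable_times h_meas measurable_next_mean order_refl)
    \<comment> \<open>With \<open>x = T n \<omega> - 1 / 2\<close>, adding one ball lowers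
      \<open>1 / x\<close> by \<open>1 / (x * (x + 1))\<close>, so \<open>h\<close> is the
      coefficient of the event. Replacing the event by its conditional mean \<open>?q\<close> leaves
      a centred term that integrates to zero.\<close>
    have AV_Suc: "A n \<omega> * V (Suc n) \<omega> = (g \<omega> - h \<omega> * ?q n \<omega>) - h \<omega> * (?b (X (Suc n) \<omega>) - ?q n \<omega>)" for \<omega>
    proof -
      have "1 / (x + 1) = 1 / x - 1 / x / (x + 1)" if "0 < x" for x :: real
        using that add_pos_pos[OF that mult_pos_pos[OF that that]] by (simp add: field_simps)
      from this[of "T n \<omega> - 1 / 2"]
      have "1 / (T n \<omega> + 1 - 1 / 2) = 1 / (T n \<omega> - 1 / 2) - 1 / (T n \<omega> - 1 / 2) / (T n \<omega> + 1 / 2)"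
        using T_half[of n \<omega>] by (simp add: diff_add_eq)
      from arg_cong[where f = "\<lambda>x. A n \<omega> * (N (Suc n) * x)", OF this]
      have "A n \<omega> * V (Suc n) \<omega> = g \<omega> - h \<omega> * ?b (X (Suc n) \<omega>)"
        unfolding V_def h_def g_def T_Suc
        by (cases "B (X (Suc n) \<omega>)") (auto simp: right_diff_distrib)
      then show ?thesis
        by (simp add: algebra_simps)
    qed
    have "expectation (\<lambda>\<omega>. A (Suc n) \<omega> * V (Suc n) \<omega>) \<le> expectation (\<lambda>\<omega>. A n \<omega> * V (Suc n) \<omega>)"
    proof (rule integral_mono)
      show "integrable P (\<lambda>\<omega>. A (Suc n) \<omega> * V (Suc n) \<omega>)"
        unfolding V_def using N by (intro AV_int) auto
      show "integrable P (\<lambda>\<omega>. A n \<omega> * V (Suc n) \<omega>)"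
        unfolding AV_Suc using g_int q_int centred(1) by (intro Bochner_Integration.integrable_diff) auto
      show "A (Suc n) \<omega> * V (Suc n) \<omega> \<le> A n \<omega> * V (Suc n) \<omega>" for \<omega>
        using V_pos[of "Suc n" \<omega>] by (intro mult_right_mono) (auto simp: A_def)
    qed
    also have "\<dots> = expectation (\<lambda>\<omega>. g \<omega> - h \<omega> * ?q n \<omega>)"
      unfolding AV_Suc using g_int q_int centred by (subst Bochner_Integration.integral_diff) auto
    also have "\<dots> \<le> expectation (\<lambda>\<omega>. (1 - 1 / (6 * N n)) * (A n \<omega> * V n \<omega>))"
    proof (rule integral_mono)
      show "integrable P (\<lambda>\<omega>. g \<omega> - h \<omega> * ?q n \<omega>)"
        using g_int q_int by simp
      show "integrable P (\<lambda>\<omega>. (1 - 1 / (6 * N n)) * (A n \<omega> * V n \<omega>))"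
        unfolding V_def using N by (intro integrable_mult_right AV_int) auto
      fix \<omega>
      let ?t = "T n \<omega>"
      show "g \<omega> - h \<omega> * ?q n \<omega> \<le> (1 - 1 / (6 * N n)) * (A n \<omega> * V n \<omega>)"
      proof (cases "A n \<omega> = 0")
        case False
        then have A1: "A n \<omega> = 1" and le: "?t \<le> \<eta> * N n"
          using n by (auto simp: A_def split: if_splits)
        have "2 / 3 \<le> ?t / (?t + 1 / 2)"
          using T_ge_1[of n \<omega>] by (simp add: field_simps)
        then have "7 / 6 \<le> 7 / 4 * (?t / (?t + 1 / 2))"
          by linarith
        then have "7 / 6 / N n \<le> 7 / 4 * (?t / (?t + 1 / 2)) / N n"
          by (rule divide_right_mono) (use N in linarith)
        also have "\<dots> = 7 / 4 * ?t / N n / (?t + 1 / 2)"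
          by simp
        also have "\<dots> \<le> ?q n \<omega> / (?t + 1 / 2)"
          using drift[OF n le] T_half[of n \<omega>] by (intro divide_right_mono) auto
        finally have "(N n + 1) * (1 - ?q n \<omega> / (?t + 1 / 2)) \<le> (N n + 1) * (1 - 7 / 6 / N n)"
          using N by (intro mult_left_mono) auto
        \<comment> \<open>The left-hand side is \<open>N n - 1 / 6 - 7 / (6 * N n)\<close>, and the
          right-hand side is \<open>N n - 1 / 6\<close>.\<close>
        also have "\<dots> \<le> (1 - 1 / (6 * N n)) * N n"
          using N by (simp add: field_simps)
        finally have "1 / (?t - 1 / 2) * ((N n + 1) * (1 - ?q n \<omega> / (?t + 1 / 2)))
            \<le> 1 / (?t - 1 / 2) * ((1 - 1 / (6 * N n)) * N n)"
          using inv_bounds by (intro mult_left_mono) auto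
        moreover have "g \<omega> - h \<omega> * ?q n \<omega> = 1 / (?t - 1 / 2) * ((N n + 1) * (1 - ?q n \<omega> / (?t + 1 / 2)))"
          by (simp add: h_def g_def A1 N right_diff_distrib)
        moreover have "(1 - 1 / (6 * N n)) * (A n \<omega> * V n \<omega>) = 1 / (?t - 1 / 2) * ((1 - 1 / (6 * N n)) * N n)"
          by (simp add: V_def A1)
        ultimately show ?thesis by simp
      qed (simp add: g_def h_def)
    qed
    finally show ?thesis by simp
  qed
  have e_nonneg: "0 \<le> e k" for k
    unfolding e_def using A_bounds V_pos by (intro integral_nonneg_AE AE_I2 mult_nonneg_nonneg) auto
  \<comment> \<open>The contraction is read as an almost decreasing sequence with
    \<open>q = 0\<close>; the summability of \<open>e k / N (n0 + k)\<close> then forces the limit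
    0.\<close>
  have e_step: "e (Suc k) \<le> e k - e k / (6 * N (n0 + k)) + 0" for k
    using step[of "n0 + k"] by (simp add: e_def left_diff_distrib)
  have w_nonneg: "0 \<le> e k / (6 * N (n0 + k))" for k
    using e_nonneg N_pos[of "n0 + k"] by simp
  note dec = almost_decreasing[where x = e and w = "\<lambda>k. e k / (6 * N (n0 + k))" and q = "\<lambda>_. 0",
      OF e_step e_nonneg w_nonneg summable_zero]
  from dec(1) obtain L where L: "e \<longlonglongrightarrow> L"
    by (auto simp: convergent_def)
  have "summable (\<lambda>k. 6 * (e k / (6 * N (n0 + k))))"
    by (intro summable_mult dec(2))
  moreover have "6 * (e k / (6 * N (n0 + k))) = e k / real (k + (n0 + initial_balls d S0))" for k
  proof -
    have "N (n0 + k) = real (k + (n0 + initial_balls d S0))"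
      by (simp add: N_def)
    then show ?thesis
      by (simp del: of_nat_add)
  qed
  ultimately have "summable (\<lambda>k. e k / real (k + (n0 + initial_balls d S0)))"
    by (simp only:)
  then have "L = 0"
    using limit_zero_if_summable_div[OF L e_nonneg] by blast
  define S where "S = {\<omega> \<in> space P. \<forall>n\<in>{n0..}. T n \<omega> \<le> \<eta> * N n}"
  have [measurable]: "T n \<in> borel_measurable P" for n
    using T_meas[of n n] measurable_F_imp by blast
  have S: "S \<in> events"
    unfolding S_def by measurable
  have "prob S \<le> e k" for k
  proof -
    have "prob S = expectation (indicator S)"
      using S by simp
    \<comment> \<open>On \<open>S\<close> nothing has been killed, and
      \<open>T \<le> \<eta> * N \<le> N\<close> gives \<open>V \<ge> 1\<close>. Thus the vanishing
      expectation bounds the probability.\<close>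
    also have "\<dots> \<le> expectation (\<lambda>\<omega>. A (n0 + k) \<omega> * V (n0 + k) \<omega>)"
    proof (rule integral_mono)
      show "integrable P (indicator S :: 'a \<Rightarrow> real)"
        using S by (intro integrable_const_bound[of _ 1] AE_I2 borel_measurable_indicator)
          (simp_all add: indicator_abs_le_1)
      show "integrable P (\<lambda>\<omega>. A (n0 + k) \<omega> * V (n0 + k) \<omega>)"
        unfolding V_def using N_pos[of "n0 + k"] by (intro AV_int) auto
      fix \<omega>
      show "indicator S \<omega> \<le> A (n0 + k) \<omega> * V (n0 + k) \<omega>"
      proof (cases "\<omega> \<in> S")
        case True
        then have "A (n0 + k) \<omega> = 1" and "T (n0 + k) \<omega> \<le> \<eta> * N (n0 + k)"
          by (auto simp: S_def A_def)
        moreover have "\<eta> * N (n0 + k) \<le> 1 * N (n0 + k)"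
          using \<eta> N_pos[of "n0 + k"] by (intro mult_right_mono) auto
        ultimately show ?thesis
          using True T_half[of "n0 + k" \<omega>] by (simp add: V_def field_simps)
      qed (use A_bounds V_pos in simp)
    qed
    finally show ?thesis by (simp add: e_def)
  qed
  then have "prob S \<le> L"
    using L by (intro LIMSEQ_le_const) auto
  then have "prob S = 0"
    using \<open>L = 0\<close> measure_nonneg[of P S] by linarith
  then have "AE \<omega> in P. \<omega> \<notin> S"
    using S by (simp add: prob_eq_0)
  then show ?thesis
    using AE_space by eventually_elim (auto simp: S_def)
qed

end

section \<open>A single Fourier mode\<close>

text \<open>\<open>\<psi>_sum\<close> makes the value at a new label the product of the values
  drawn, \<open>\<psi>_power\<close> makes every value a \<open>d\<close>-th root of unity, and
  \<open>\<psi>_nontrivial\<close> provides an initial ball outside the level set of 1.\<close>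

locale mau_character = mau P d S0 X Ms p
  for P :: "'a measure" and d S0 X Ms p +
  fixes \<psi> :: "int \<Rightarrow> complex"
  assumes \<psi>_sum: "\<And>xs. \<psi> (sum_list xs mod int d) = prod_list (map \<psi> xs)"
    and \<psi>_power: "\<And>j. \<psi> j ^ d = 1"
    and \<psi>_nontrivial: "\<exists>j\<in>labels. 0 < S0 j \<and> \<psi> j \<noteq> 1"
begin

definition z :: "nat \<Rightarrow> 'a \<Rightarrow> complex" where
  "z n \<omega> = (\<Sum>j\<in>labels. fraction n j \<omega> *\<^sub>R \<psi> j)"

definition r :: "nat \<Rightarrow> 'a \<Rightarrow> real" where
  "r n \<omega> = (norm (z n \<omega>))\<^sup>2"

definition off_mass :: "int \<Rightarrow> nat \<Rightarrow> 'a \<Rightarrow> real" where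
  "off_mass j0 n \<omega> = (\<Sum>j | j \<in> labels \<and> \<psi> j \<noteq> \<psi> j0. fraction n j \<omega>)"

lemma norm_\<psi>: "norm (\<psi> j) = 1"
  using \<psi>_power[of j] d by (metis norm_power norm_one norm_ge_zero power_eq_1_iff not_numeral_le_zero)

lemma norm_prod_\<psi>: "norm (prod_list (map \<psi> xs)) = 1"
  by (simp add: \<psi>_sum[symmetric] norm_\<psi>)

lemma \<psi>_new_label: "\<psi> (new_label d X i \<omega>) = prod_list (map \<psi> (X i \<omega>))"
  by (simp add: new_label_def \<psi>_sum)

lemma fraction_Suc:
  "fraction (Suc n) j \<omega> = (N n * fraction n j \<omega> + of_bool (new_label d X (Suc n) \<omega> = j)) / N (Suc n)"
  using N_pos[of n] by (simp add: fraction_eq ball_count_Suc)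

lemma z_Suc: "z (Suc n) \<omega> = (N n *\<^sub>R z n \<omega> + prod_list (map \<psi> (X (Suc n) \<omega>))) /\<^sub>R N (Suc n)"
proof -
  have "(\<Sum>j\<in>labels. of_bool (new_label d X (Suc n) \<omega> = j) *\<^sub>R \<psi> j) = \<psi> (new_label d X (Suc n) \<omega>)"
  proof -
    have "(\<Sum>j\<in>labels. of_bool (new_label d X (Suc n) \<omega> = j) *\<^sub>R \<psi> j)
        = (\<Sum>j\<in>labels. if j = new_label d X (Suc n) \<omega> then \<psi> j else 0)"
      by (intro sum.cong) auto
    then show ?thesis
      using new_label_in finite_labels by simp
  qed
  moreover have "z (Suc n) \<omega> = (N n *\<^sub>R z n \<omega>
      + (\<Sum>j\<in>labels. of_bool (new_label d X (Suc n) \<omega> = j) *\<^sub>R \<psi> j)) /\<^sub>R N (Suc n)"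
    unfolding z_def fraction_Suc scaleR_sum_right sum.distrib[symmetric]
    by (intro sum.cong refl) (simp add: scaleR_conv_of_real divide_inverse algebra_simps)
  ultimately show ?thesis
    by (simp add: \<psi>_new_label)
qed

lemma norm_z: "norm (z n \<omega>) \<le> 1"
proof -
  have "norm (z n \<omega>) \<le> (\<Sum>j\<in>labels. norm (fraction n j \<omega> *\<^sub>R \<psi> j))"
    unfolding z_def by (rule norm_sum)
  also have "\<dots> = 1"
    using sum_fraction[of n \<omega>] by (simp add: norm_\<psi> fraction_nonneg)
  finally show ?thesis .
qed

text \<open>The mean is \<open>\<Sum>m\<in>Ms. p m *\<^sub>R z n \<omega> ^ m\<close>; every size is
  at least 2 and the modulus of \<open>z\<close> at most 1, so each power has modulus at most
  \<open>r\<close>.\<close>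

lemma norm_next_mean_\<psi>:
  "norm (next_mean (\<lambda>j. fraction n j \<omega>) (\<lambda>xs. prod_list (map \<psi> xs))) \<le> r n \<omega>"
proof -
  have "next_mean (\<lambda>j. fraction n j \<omega>) (\<lambda>xs. prod_list (map \<psi> xs)) = (\<Sum>m\<in>Ms. p m *\<^sub>R z n \<omega> ^ m)"
    by (simp add: next_mean_def word_mean_prod_list z_def)
  also have "norm \<dots> \<le> (\<Sum>m\<in>Ms. p m * norm (z n \<omega>) ^ m)"
    using p(1) by (intro sum_norm_le) (auto simp: norm_power less_imp_le)
  also have "\<dots> \<le> (\<Sum>m\<in>Ms. p m * norm (z n \<omega>) ^ 2)"
    using p(1) Ms(2) norm_z by (intro sum_mono mult_left_mono power_decreasing) (auto simp: less_imp_le)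
  also have "\<dots> = r n \<omega>"
    by (simp add: sum_distrib_right[symmetric] p r_def)
  finally show ?thesis .
qed

text \<open>The centred part of the increment of \<open>r\<close>: the prefactor is that of the
  cross term of the squared norm of \<open>N z + x\<close> after division by
  \<open>(N + 1)^2\<close>. Real and imaginary parts are separated because
  \<open>expectation_centred_next\<close> is about real functions.\<close>

definition noise :: "nat \<Rightarrow> 'a \<Rightarrow> real" where
  "noise n \<omega> = 2 * N n / (N (Suc n))\<^sup>2 *
    (Re (z n \<omega>) * (Re (prod_list (map \<psi> (X (Suc n) \<omega>)))
        - next_mean (\<lambda>j. fraction n j \<omega>) (\<lambda>xs. Re (prod_list (map \<psi> xs))))
     + Im (z n \<omega>) * (Im (prod_list (map \<psi> (X (Suc n) \<omega>)))
        - next_mean (\<lambda>j. fraction n j \<omega>) (\<lambda>xs. Im (prod_list (map \<psi> xs)))))"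

lemma noise_eq:
  "noise n \<omega> = 2 * N n / (N (Suc n))\<^sup>2 *
    (z n \<omega> \<bullet> prod_list (map \<psi> (X (Suc n) \<omega>))
     - z n \<omega> \<bullet> next_mean (\<lambda>j. fraction n j \<omega>) (\<lambda>xs. prod_list (map \<psi> xs)))"
proof -
  have "next_mean (\<lambda>j. fraction n j \<omega>) (\<lambda>xs. Re (prod_list (map \<psi> xs)))
      = Re (next_mean (\<lambda>j. fraction n j \<omega>) (\<lambda>xs. prod_list (map \<psi> xs)))"
    "next_mean (\<lambda>j. fraction n j \<omega>) (\<lambda>xs. Im (prod_list (map \<psi> xs)))
      = Im (next_mean (\<lambda>j. fraction n j \<omega>) (\<lambda>xs. prod_list (map \<psi> xs)))"
    by (simp_all add: next_mean_def Re_word_mean Im_word_mean)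
  then show ?thesis
    by (simp add: noise_def inner_complex_def algebra_simps)
qed

lemma noise_bound: "\<bar>noise n \<omega>\<bar> \<le> 4 / real (Suc n)"
proof -
  let ?g = "next_mean (\<lambda>j. fraction n j \<omega>) (\<lambda>xs. prod_list (map \<psi> xs))"
  let ?x = "prod_list (map \<psi> (X (Suc n) \<omega>))"
  have "norm ?g \<le> 1"
    using norm_next_mean_\<psi>[of n \<omega>] norm_z[of n \<omega>] by (simp add: r_def power_le_one order_trans)
  then have "norm (?x - ?g) \<le> 2"
    using norm_triangle_ineq4[of ?x ?g] norm_prod_\<psi>[of "X (Suc n) \<omega>"] by linarith
  then have "\<bar>z n \<omega> \<bullet> (?x - ?g)\<bar> \<le> 1 * 2"
    by (intro order_trans[OF Cauchy_Schwarz_ineq2] mult_mono norm_z) auto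
  moreover have "2 * N n / (N (Suc n))\<^sup>2 \<le> 2 / N (Suc n)"
  proof -
    have "N n / N (Suc n) \<le> 1"
      using N_pos[of n] N_Suc[of n] by simp
    from mult_left_mono[OF this, of "2 / N (Suc n)"] show ?thesis
      using N_pos[of "Suc n"] by (simp add: power2_eq_square)
  qed
  moreover have "\<bar>2 * N n / (N (Suc n))\<^sup>2\<bar> = 2 * N n / (N (Suc n))\<^sup>2"
    using N_pos[of n] by simp
  ultimately have "\<bar>noise n \<omega>\<bar> \<le> 2 / N (Suc n) * 2"
    unfolding noise_eq inner_diff_right[symmetric] abs_mult using N_pos[of "Suc n"] by (intro mult_mono) auto
  also have "\<dots> \<le> 4 / real (Suc n)"
    using N_gt[of "Suc n"] by (simp add: frac_le)
  finally show ?thesis .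
qed

lemma measurable_Re_z: "i \<le> n \<Longrightarrow> (\<lambda>\<omega>. Re (z i \<omega>)) \<in> borel_measurable (F n)"
  and measurable_Im_z: "i \<le> n \<Longrightarrow> (\<lambda>\<omega>. Im (z i \<omega>)) \<in> borel_measurable (F n)"
  unfolding z_def Re_sum Im_sum by (auto intro!: borel_measurable_sum borel_measurable_times measurable_fraction)

lemma measurable_noise: "Suc i \<le> n \<Longrightarrow> noise i \<in> borel_measurable (F n)"
  unfolding noise_def
  by (intro borel_measurable_times borel_measurable_add borel_measurable_diff borel_measurable_const
      measurable_Re_z measurable_Im_z measurable_next_mean measurable_draw_function) auto

text \<open>For \<open>i < j\<close> both \<open>noise i\<close> and \<open>z j\<close> are
  determined by the first \<open>j\<close> draws, so their product can serve as the test function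
  against the centred draw at stage \<open>Suc j\<close>.\<close>

lemma noise_orthogonal:
  assumes "i < j"
  shows "expectation (\<lambda>\<omega>. noise i \<omega> * noise j \<omega>) = 0"
proof -
  let ?c = "2 * N j / (N (Suc j))\<^sup>2"
  let ?re = "\<lambda>xs. Re (prod_list (map \<psi> xs))" and ?im = "\<lambda>xs. Im (prod_list (map \<psi> xs))"
  have bound: "\<bar>?c * noise i \<omega> * w\<bar> \<le> ?c * (4 / real (Suc i)) * 1" if "\<bar>w\<bar> \<le> 1" for \<omega> w
    unfolding abs_mult using N_pos[of j] noise_bound[of i \<omega>] that by (intro mult_mono) auto
  have re: "\<bar>?re xs\<bar> \<le> 1" and im: "\<bar>?im xs\<bar> \<le> 1" for xs
    using abs_Re_le_cmod[of "prod_list (map \<psi> xs)"] abs_Im_le_cmod[of "prod_list (map \<psi> xs)"]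
    by (auto simp: norm_prod_\<psi>)
  have zre: "\<bar>Re (z j \<omega>)\<bar> \<le> 1" and zim: "\<bar>Im (z j \<omega>)\<bar> \<le> 1" for \<omega>
    using abs_Re_le_cmod[of "z j \<omega>"] abs_Im_le_cmod[of "z j \<omega>"] norm_z[of j \<omega>] by auto
  have m1: "(\<lambda>\<omega>. ?c * noise i \<omega> * Re (z j \<omega>)) \<in> borel_measurable (F j)"
    and m2: "(\<lambda>\<omega>. ?c * noise i \<omega> * Im (z j \<omega>)) \<in> borel_measurable (F j)"
    using assms by (intro borel_measurable_times borel_measurable_const measurable_noise
      measurable_Re_z measurable_Im_z; simp)+
  note c1 = expectation_centred_next[where f = ?re, OF m1 bound[OF zre] re]
    and c2 = expectation_centred_next[where f = ?im, OF m2 bound[OF zim] im]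
  have eq: "noise i \<omega> * noise j \<omega>
      = ?c * noise i \<omega> * Re (z j \<omega>) * (?re (X (Suc j) \<omega>) - next_mean (\<lambda>k. fraction j k \<omega>) ?re)
      + ?c * noise i \<omega> * Im (z j \<omega>) * (?im (X (Suc j) \<omega>) - next_mean (\<lambda>k. fraction j k \<omega>) ?im)" for \<omega>
    unfolding noise_def[of j] by (simp only: distrib_left mult_ac)
  show ?thesis
    unfolding eq Bochner_Integration.integral_add[OF c1(1) c2(1)] c1(2) c2(2) by simp
qed

lemma r_Suc: "r (Suc n) \<omega>
  \<le> r n \<omega> - 2 * N n / (N (Suc n))\<^sup>2 * (r n \<omega> * (1 - norm (z n \<omega>))) + (1 / (N (Suc n))\<^sup>2 + noise n \<omega>)"
proof -
  let ?g = "next_mean (\<lambda>j. fraction n j \<omega>) (\<lambda>xs. prod_list (map \<psi> xs))"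
  let ?x = "prod_list (map \<psi> (X (Suc n) \<omega>))"
  let ?M = "(N (Suc n))\<^sup>2"
  have N: "1 \<le> N n" and M: "0 < ?M" "?M = (N n)\<^sup>2 + 2 * N n + 1"
    using N_pos[of n] N_pos[of "Suc n"] by (simp, simp, simp add: N_Suc power2_eq_square algebra_simps)
  have "r (Suc n) \<omega> = ((norm (N n *\<^sub>R z n \<omega> + ?x))\<^sup>2) / ?M"
    unfolding r_def z_Suc by (simp add: power_mult_distrib power_divide divide_inverse_commute power_inverse)
  also have "(norm (N n *\<^sub>R z n \<omega> + ?x))\<^sup>2 = (N n)\<^sup>2 * r n \<omega> + 2 * N n * (z n \<omega> \<bullet> ?x) + 1"
    using dot_norm[of "N n *\<^sub>R z n \<omega>" ?x] norm_prod_\<psi>[of "X (Suc n) \<omega>"]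
    by (simp add: r_def power_mult_distrib)
  also have "\<dots> / ?M = (?M * noise n \<omega> + ((N n)\<^sup>2 * r n \<omega> + 2 * N n * (z n \<omega> \<bullet> ?g) + 1)) / ?M"
    using M(1) unfolding noise_eq by (simp add: right_diff_distrib add.commute)
  also have "\<dots> = noise n \<omega> + ((N n)\<^sup>2 * r n \<omega> + 2 * N n * (z n \<omega> \<bullet> ?g) + 1) / ?M"
    using M(1) by (simp add: add_divide_distrib)
  \<comment> \<open>Cauchy-Schwarz bounds the inner product by
    \<open>norm (z n \<omega>) * r n \<omega>\<close>. Writing \<open>(N n)\<^sup>2\<close> as
    \<open>?M - 2 * N n - 1\<close> leaves a term \<open>- r n \<omega>\<close>, which is
    dropped.\<close>
  also have "\<dots> \<le> noise n \<omega> + ((?M * r n \<omega> - 2 * N n * (r n \<omega> * (1 - norm (z n \<omega>)))) + 1) / ?M"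
  proof (intro add_left_mono divide_right_mono add_right_mono)
    have "z n \<omega> \<bullet> ?g \<le> norm (z n \<omega>) * norm ?g"
      by (rule norm_cauchy_schwarz)
    also have "\<dots> \<le> norm (z n \<omega>) * r n \<omega>"
      by (intro mult_left_mono norm_next_mean_\<psi>) auto
    finally have "2 * N n * (z n \<omega> \<bullet> ?g) \<le> 2 * N n * (norm (z n \<omega>) * r n \<omega>)"
      using N by (intro mult_left_mono) auto
    moreover have "0 \<le> r n \<omega>" by (simp add: r_def)
    ultimately show "(N n)\<^sup>2 * r n \<omega> + 2 * N n * (z n \<omega> \<bullet> ?g)
        \<le> ?M * r n \<omega> - 2 * N n * (r n \<omega> * (1 - norm (z n \<omega>)))"
      unfolding M(2) by (simp add: algebra_simps)
  qed auto
  also have "\<dots> = r n \<omega> - 2 * N n / ?M * (r n \<omega> * (1 - norm (z n \<omega>))) + (1 / ?M + noise n \<omega>)"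
    using M(1) by (simp add: add_divide_distrib diff_divide_distrib)
  finally show ?thesis .
qed

text \<open>On a path whose noise series converges, \<open>r\<close> has a limit \<open>L\<close>
  and the drift is summable. The drift coefficients are of harmonic order, so
  \<open>L * (1 - sqrt L)\<close> must vanish.\<close>

lemma AE_r_dichotomy: "AE \<omega> in P. (\<lambda>n. r n \<omega>) \<longlonglongrightarrow> 0 \<or> (\<lambda>n. r n \<omega>) \<longlonglongrightarrow> 1"
proof -
  have "AE \<omega> in P. summable (\<lambda>n. noise n \<omega>)"
    by (rule AE_summable_orthogonal[OF measurable_F_imp[OF measurable_noise[OF order_refl]] noise_bound noise_orthogonal])
  then show ?thesis
  proof eventually_elim
    case (elim \<omega>)
    let ?f = "\<lambda>n. r n \<omega> * (1 - norm (z n \<omega>))"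
    have f: "0 \<le> ?f n" for n
      using norm_z[of n \<omega>] by (simp add: r_def)
    have w: "0 \<le> 2 * N n / (N (Suc n))\<^sup>2 * ?f n" for n
      using f[of n] N_pos[of n] by simp
    have "summable (\<lambda>n. 1 / (N (Suc n))\<^sup>2)"
    proof (rule summable_comparison_test')
      show "summable (\<lambda>n. inverse (real (Suc n) ^ 2))"
        using inverse_power_summable[of 2, where 'a = real] by (subst summable_Suc_iff) simp
      fix n :: nat
      have "real (Suc n) ^ 2 \<le> (N (Suc n))\<^sup>2"
        using N_gt[of "Suc n"] by (intro power_mono) auto
      then show "norm (1 / (N (Suc n))\<^sup>2) \<le> inverse (real (Suc n) ^ 2)"
        by (simp add: inverse_eq_divide frac_le del: of_nat_Suc)
    qed
    then have q: "summable (\<lambda>n. 1 / (N (Suc n))\<^sup>2 + noise n \<omega>)"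
      using elim by (rule summable_add)
    have r_nonneg: "0 \<le> r n \<omega>" for n by (simp add: r_def)
    note dec = almost_decreasing[where x = "\<lambda>n. r n \<omega>" and w = "\<lambda>n. 2 * N n / (N (Suc n))\<^sup>2 * ?f n",
        OF r_Suc r_nonneg w q]
    from dec(1) obtain L where L: "(\<lambda>n. r n \<omega>) \<longlonglongrightarrow> L"
      by (auto simp: convergent_def)
    have norm_z_eq: "norm (z n \<omega>) = sqrt (r n \<omega>)" for n
      by (simp add: r_def)
    have "?f \<longlonglongrightarrow> L * (1 - sqrt L)"
      unfolding norm_z_eq by (intro tendsto_intros L)
    moreover have "summable (\<lambda>n. ?f n / real (n + initial_balls d S0))"
    proof (rule summable_comparison_test')
      show "summable (\<lambda>n. 2 * (2 * N n / (N (Suc n))\<^sup>2 * ?f n))"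
        by (intro summable_mult dec(2))
      fix n
      \<comment> \<open>From \<open>N n + 1 \<le> 2 * N n\<close>, the drift coefficient is at least
        half of \<open>1 / N n\<close>.\<close>
      have "(N (Suc n))\<^sup>2 \<le> (2 * N n)\<^sup>2"
        using N_pos[of n] N_Suc[of n] by (intro power_mono) auto
      then have "1 / N n \<le> 2 * (2 * N n / (N (Suc n))\<^sup>2)"
        using N_pos[of n] N_pos[of "Suc n"] by (simp add: field_simps power2_eq_square)
      from mult_right_mono[OF this f[of n]]
      have "?f n / N n \<le> 2 * (2 * N n / (N (Suc n))\<^sup>2 * ?f n)"
        by (simp only: mult.assoc) simp
      moreover have "0 \<le> ?f n / N n"
        using f[of n] N_pos[of n] by simp
      ultimately show "norm (?f n / real (n + initial_balls d S0)) \<le> 2 * (2 * N n / (N (Suc n))\<^sup>2 * ?f n)"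
        by (simp only: N_def[of n, symmetric] real_norm_def abs_of_nonneg)
    qed
    ultimately have "L * (1 - sqrt L) = 0"
      using f limit_zero_if_summable_div by blast
    then have "L = 0 \<or> L = 1" by auto
    with L show ?case by auto
  qed
qed

end

section \<open>Exclusion of modulus one\<close>

lemma eq_1_if_coprime_powers:
  fixes x :: "'a :: field"
  assumes "x ^ d = 1" and "x ^ k = 1" and "coprime k d" and "d \<noteq> 0"
  shows "x = 1"
proof -
  obtain a b where "d * a = k * b + gcd d k"
    using bezout_nat[OF \<open>d \<noteq> 0\<close>, of k] by blast
  then have "d * a = Suc (k * b)"
    using assms(3) by (simp add: coprime_iff_gcd_eq_1 gcd.commute)
  then have "(x ^ d) ^ a = x * (x ^ k) ^ b"
    by (simp only: power_mult[symmetric] power_Suc)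
  then show ?thesis
    unfolding assms(1,2) by simp
qed

context mau_character
begin

lemma off_mass_nonneg: "0 \<le> off_mass j0 n \<omega>"
  unfolding off_mass_def by (intro sum_nonneg) (simp add: fraction_nonneg)

lemma off_mass_Suc:
  "N (Suc n) * off_mass j0 (Suc n) \<omega>
    = N n * off_mass j0 n \<omega> + of_bool (prod_list (map \<psi> (X (Suc n) \<omega>)) \<noteq> \<psi> j0)"
proof -
  let ?S = "{j \<in> labels. \<psi> j \<noteq> \<psi> j0}" and ?l = "new_label d X (Suc n) \<omega>"
  have "N (Suc n) * fraction (Suc n) j \<omega> = N n * fraction n j \<omega> + of_bool (?l = j)" for j
    using N_pos[of "Suc n"] by (simp add: fraction_Suc)
  then have "N (Suc n) * off_mass j0 (Suc n) \<omega> = N n * off_mass j0 n \<omega> + (\<Sum>j\<in>?S. of_bool (?l = j))"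
    by (simp add: off_mass_def sum_distrib_left sum.distrib)
  also have "(\<Sum>j\<in>?S. of_bool (?l = j)) = (\<Sum>j\<in>?S. if j = ?l then 1 else 0 :: real)"
    by (intro sum.cong) auto
  also have "\<dots> = of_bool (\<psi> ?l \<noteq> \<psi> j0)"
    using finite_labels new_label_in[of "Suc n" \<omega>] by simp
  finally show ?thesis
    by (simp add: \<psi>_new_label)
qed

definition off_count :: "int \<Rightarrow> nat \<Rightarrow> 'a \<Rightarrow> real" where
  "off_count j0 n \<omega> = N n * off_mass j0 n \<omega> + of_bool (\<psi> j0 \<noteq> 1)"

text \<open>For the level set of 1, the initial ball from \<open>\<psi>_nontrivial\<close> lies
  outside and is never removed; for any other level set the added unit suffices.\<close>

lemma off_count_ge_1: "1 \<le> off_count j0 n \<omega>"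
proof (cases "\<psi> j0 = 1")
  case True
  obtain j where j: "j \<in> labels" "0 < S0 j" "\<psi> j \<noteq> 1"
    using \<psi>_nontrivial by blast
  have "1 \<le> real (ball_count d S0 X n j \<omega>)"
    using j by (simp add: ball_count_def)
  also have "\<dots> = N n * fraction n j \<omega>"
    using N_pos[of n] by (simp add: fraction_eq)
  also have "\<dots> \<le> N n * off_mass j0 n \<omega>"
    unfolding off_mass_def using j True finite_labels N_pos[of n]
    by (intro mult_left_mono member_le_sum) (auto simp: fraction_nonneg)
  finally show ?thesis
    by (simp add: off_count_def)
next
  case False
  then show ?thesis
    using off_mass_nonneg[of j0 n \<omega>] N_pos[of n] by (simp add: off_count_def)
qed

lemma next_mean_ge:
  assumes "m \<in> Ms" and "\<And>xs. (0 :: real) \<le> f xs"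
  shows "p m * word_mean labels (\<lambda>j. fraction n j \<omega>) m f \<le> next_mean (\<lambda>j. fraction n j \<omega>) f"
proof -
  have "0 \<le> word_mean labels (\<lambda>j. fraction n j \<omega>) m' f" if "m' \<in> Ms" for m'
    unfolding word_mean_def using assms(2)
    by (intro sum_nonneg scaleR_nonneg_nonneg prod_list_nonneg) (auto simp: fraction_nonneg)
  then show ?thesis
    unfolding next_mean_def real_scaleR_def using assms(1) Ms(1) p(1)
    by (intro member_le_sum[where f = "\<lambda>m. p m * word_mean labels (\<lambda>j. fraction n j \<omega>) m f"])
      (auto intro!: mult_nonneg_nonneg simp: less_imp_le)
qed

lemma AE_not_concentrated:
  "\<exists>\<eta>>0. \<eta> \<le> 1 / 16 \<and>
    (\<forall>j0\<in>labels. \<forall>n0. AE \<omega> in P. \<not> (\<forall>n\<ge>n0. off_count j0 n \<omega> \<le> \<eta> * N n))"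
proof -
  obtain m where m: "m \<in> Ms" "coprime (m - 1) d"
    using coprime_size by blast
  \<comment> \<open>The bound \<open>1 / 16\<close> gives \<open>2 * (1 - y) \<ge> 7 / 4\<close> and
    \<open>1 - y \<ge> 1 / 2\<close>. The second bound keeps \<open>7 / 4 * \<eta>\<close> below
    \<open>p m * (1 / 2) ^ m\<close>, the escape probability available when
    \<open>\<psi> j0 \<noteq> 1\<close>.\<close>
  define \<eta> where "\<eta> = min (1 / 16) (p m / (2 * 2 ^ m))"
  have \<eta>: "0 < \<eta>" "\<eta> \<le> 1 / 16" "\<eta> \<le> p m / (2 * 2 ^ m)"
    using p(1)[OF m(1)] by (auto simp: \<eta>_def)
  have "AE \<omega> in P. \<not> (\<forall>n\<ge>n0. off_count j0 n \<omega> \<le> \<eta> * N n)" for j0 n0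
  proof (rule AE_escapes[where B = "\<lambda>xs. prod_list (map \<psi> xs) \<noteq> \<psi> j0"])
    show "off_count j0 i \<in> borel_measurable (F n)" if "i \<le> n" for i n
      unfolding off_count_def off_mass_def using that
      by (intro borel_measurable_add borel_measurable_times borel_measurable_sum borel_measurable_const
        measurable_fraction)
    show "1 \<le> off_count j0 n \<omega>" for n \<omega>
      by (rule off_count_ge_1)
    show "off_count j0 (Suc n) \<omega>
        = off_count j0 n \<omega> + of_bool (prod_list (map \<psi> (X (Suc n) \<omega>)) \<noteq> \<psi> j0)" for n \<omega>
      by (simp add: off_count_def off_mass_Suc)
    show "\<eta> \<le> 1"
      using \<eta> by simp
    fix n \<omega> assume le: "off_count j0 n \<omega> \<le> \<eta> * N n"
    let ?y = "off_mass j0 n \<omega>" and ?a = "\<lambda>j. fraction n j \<omega>"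
    let ?f = "\<lambda>xs. of_bool (prod_list (map \<psi> xs) \<noteq> \<psi> j0) :: real"
    have N: "0 < N n"
      using N_pos[of n] by simp
    have ratio: "off_count j0 n \<omega> / N n \<le> \<eta>"
      using le N by (simp add: field_simps)
    have "?y \<le> off_count j0 n \<omega> / N n"
      using N by (simp add: off_count_def field_simps)
    then have y: "?y \<le> 1 / 16"
      using order_trans[OF ratio \<eta>(2)] by (rule order_trans)
    show "7 / 4 * off_count j0 n \<omega> / N n \<le> next_mean ?a ?f"
    proof (cases "\<psi> j0 = 1")
      case True
      have "7 / 4 * off_count j0 n \<omega> / N n = ?y * (7 / 4)"
        using N True by (simp add: off_count_def)
      also have "\<dots> \<le> ?y * (2 * (1 - ?y))"
        using y by (intro mult_left_mono off_mass_nonneg) (simp add: right_diff_distrib)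
      also have "\<dots> = (\<Sum>m\<in>Ms. p m * (2 * ?y * (1 - ?y)))"
        by (simp add: sum_distrib_right[symmetric] p)
      also have "\<dots> \<le> next_mean ?a ?f"
        unfolding next_mean_def real_scaleR_def
      proof (intro sum_mono mult_left_mono)
        fix m assume "m \<in> Ms"
        then show "2 * ?y * (1 - ?y) \<le> word_mean labels ?a m ?f"
          unfolding True using True y
          by (intro word_mean_prod_neq_1 finite_labels fraction_nonneg sum_fraction Ms(2))
            (auto simp: off_mass_def)
      qed (use p(1) in \<open>auto simp: less_imp_le\<close>)
      finally show ?thesis .
    next
      case False
      have "\<psi> j0 ^ m \<noteq> \<psi> j0"
      proof
        assume eq: "\<psi> j0 ^ m = \<psi> j0"
        have "\<psi> j0 \<noteq> 0"
          using norm_\<psi>[of j0] by auto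
        moreover have "m = Suc (m - 1)"
          using Ms(2)[OF m(1)] by simp
        ultimately have "\<psi> j0 ^ (m - 1) = 1"
          using eq by (metis mult_cancel_left2 power_Suc)
        then show False
          using eq_1_if_coprime_powers[OF \<psi>_power _ m(2)] d False by auto
      qed
      \<comment> \<open>Away from the value 1 the escape probability is bounded below by a constant,
        so it dominates the ratio, which is at most \<open>\<eta>\<close>.\<close>
      have "7 / 4 * off_count j0 n \<omega> / N n \<le> 7 / 4 * \<eta>"
        using ratio by simp
      also have "\<dots> \<le> 7 / 4 * (p m / (2 * 2 ^ m))"
        using \<eta>(3) by simp
      also have "\<dots> \<le> p m * (1 / 2) ^ m"
        using p(1)[OF m(1)] by (simp add: power_one_over field_simps)
      also have "\<dots> \<le> p m * (1 - ?y) ^ m"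
        using p(1)[OF m(1)] y by (intro mult_left_mono power_mono) auto
      also have "\<dots> \<le> p m * word_mean labels ?a m ?f"
        unfolding off_mass_def using p(1)[OF m(1)] \<open>\<psi> j0 ^ m \<noteq> \<psi> j0\<close>
        by (intro mult_left_mono word_mean_prod_neq finite_labels fraction_nonneg sum_fraction) auto
      also have "\<dots> \<le> next_mean ?a ?f"
        using m(1) by (intro next_mean_ge) auto
      finally show ?thesis .
    qed
  qed
  with \<eta> show ?thesis by blast
qed

lemma norm_gap:
  "\<exists>\<gamma>>0. \<forall>j\<in>labels. \<forall>j'\<in>labels. \<psi> j \<noteq> \<psi> j' \<longrightarrow> \<gamma> \<le> (norm (\<psi> j - \<psi> j'))\<^sup>2"
proof -
  define I where "I = {(j, j') \<in> labels \<times> labels. \<psi> j \<noteq> \<psi> j'}"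
  \<comment> \<open>The inserted \<open>1\<close> makes \<open>Min G\<close> meaningful without a
    nonemptiness proof for \<open>I\<close>.\<close>
  define G where "G = insert 1 ((\<lambda>(j, j'). (norm (\<psi> j - \<psi> j'))\<^sup>2) ` I)"
  have "I \<subseteq> labels \<times> labels"
    unfolding I_def by blast
  then have "finite I"
    by (rule finite_subset) (intro finite_cartesian_product finite_labels)
  then have fin: "finite G"
    unfolding G_def by simp
  have "0 < x" if "x \<in> G" for x
    using that unfolding G_def I_def by auto
  moreover have "Min G \<in> G"
    using fin by (rule Min_in) (simp add: G_def)
  ultimately have "0 < Min G"
    by blast
  moreover have "Min G \<le> (norm (\<psi> j - \<psi> j'))\<^sup>2"
    if "j \<in> labels" "j' \<in> labels" "\<psi> j \<noteq> \<psi> j'" for j j'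
  proof (rule Min_le[OF fin])
    have "(j, j') \<in> I"
      using that by (simp add: I_def)
    from imageI[OF this, of "\<lambda>(j, j'). (norm (\<psi> j - \<psi> j'))\<^sup>2"]
    show "(norm (\<psi> j - \<psi> j'))\<^sup>2 \<in> G"
      by (simp add: G_def)
  qed
  ultimately show ?thesis
    by blast
qed

text \<open>A modulus near 1 yields, at each time separately, a level set carrying almost all mass.
  One new ball changes the mass off a level set too little for the dominant set to switch, so one
  \<open>j0\<close> serves all late times. Working with \<open>\<eta> / 2\<close> leaves room for
  the change in one step and for the unit added in \<open>off_count\<close>.\<close>

lemma persistent_concentration:
  assumes r: "(\<lambda>n. r n \<omega>) \<longlonglongrightarrow> 1" and \<eta>: "0 < \<eta>" "\<eta> \<le> 1 / 2"
  shows "\<exists>j0\<in>labels. \<exists>n0. \<forall>n\<ge>n0. off_count j0 n \<omega> \<le> \<eta> * N n"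
proof -
  obtain \<gamma> where \<gamma>: "0 < \<gamma>" "\<And>j j'. j \<in> labels \<Longrightarrow> j' \<in> labels \<Longrightarrow> \<psi> j \<noteq> \<psi> j' \<Longrightarrow> \<gamma> \<le> (norm (\<psi> j - \<psi> j'))\<^sup>2"
    using norm_gap by blast
  have labels_ne: "labels \<noteq> {}"
    using d by (simp add: labels_eq)
  have "(\<lambda>n. 2 * real (card labels) * (1 - r n \<omega>)) \<longlonglongrightarrow> 2 * real (card labels) * (1 - 1)"
    by (intro tendsto_intros r)
  then have "\<forall>\<^sub>F n in sequentially. 2 * real (card labels) * (1 - r n \<omega>) < \<gamma> * (\<eta> / 2)"
    using \<gamma> \<eta> by (intro order_tendstoD(2)) auto
  moreover have "\<forall>\<^sub>F n in sequentially. 2 / \<eta> \<le> N n"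
    by (rule eventually_mono[OF eventually_ge_at_top[of "nat \<lceil>2 / \<eta>\<rceil>"]])
      (metis N_gt nat_ceiling_le_eq less_imp_le order_trans)
  ultimately have "\<forall>\<^sub>F n in sequentially.
      2 * real (card labels) * (1 - r n \<omega>) < \<gamma> * (\<eta> / 2) \<and> 2 / \<eta> \<le> N n"
    by (rule eventually_conj)
  then obtain n0 where n0: "\<And>n. n0 \<le> n \<Longrightarrow> 2 * real (card labels) * (1 - r n \<omega>) < \<gamma> * (\<eta> / 2)"
    "\<And>n. n0 \<le> n \<Longrightarrow> 2 / \<eta> \<le> N n"
    unfolding eventually_sequentially by blast
  have N_large: "1 / N n \<le> \<eta> / 2" if "n0 \<le> n" for n
    using n0(2)[OF that] \<eta> N_pos[of n] by (simp add: field_simps)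
  have conc: "\<exists>j0\<in>labels. off_mass j0 n \<omega> < \<eta> / 2" if n: "n0 \<le> n" for n
  proof -
    obtain j0 where j0: "j0 \<in> labels"
      "\<gamma> * off_mass j0 n \<omega> \<le> 2 * real (card labels) * (1 - r n \<omega>)"
      using concentrated_if_norm_mean_near_1[where u = \<psi> and a = "\<lambda>j. fraction n j \<omega>",
        OF finite_labels labels_ne fraction_nonneg sum_fraction norm_\<psi> \<gamma>(2)]
      unfolding off_mass_def r_def z_def by blast
    then have "\<gamma> * off_mass j0 n \<omega> < \<gamma> * (\<eta> / 2)"
      using n0(1)[OF n] by linarith
    then have "off_mass j0 n \<omega> < \<eta> / 2"
      using \<gamma>(1) by simp
    with j0 show ?thesis by blast
  qed
  obtain j0 where j0: "j0 \<in> labels" "off_mass j0 n0 \<omega> < \<eta> / 2"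
    using conc by blast
  have stay: "off_mass j0 n \<omega> < \<eta> / 2" if "n0 \<le> n" for n
    using that
  proof (induction n rule: dec_induct)
    case base
    show ?case by (rule j0)
  next
    case (step n)
    obtain j1 where j1: "j1 \<in> labels" "off_mass j1 (Suc n) \<omega> < \<eta> / 2"
      using conc[of "Suc n"] step by auto
    show ?case
    proof (cases "\<psi> j1 = \<psi> j0")
      case True
      with j1 show ?thesis by (simp add: off_mass_def)
    next
      case False
      have "N (Suc n) * off_mass j0 (Suc n) \<omega> \<le> N n * off_mass j0 n \<omega> + 1"
        by (simp add: off_mass_Suc)
      also have "\<dots> \<le> N (Suc n) * off_mass j0 n \<omega> + 1"
        using off_mass_nonneg[of j0 n \<omega>] by (simp add: N_Suc algebra_simps)
      finally have "off_mass j0 (Suc n) \<omega> \<le> off_mass j0 n \<omega> + 1 / N (Suc n)"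
        using N_pos[of "Suc n"] by (simp add: field_simps)
      then have small: "off_mass j0 (Suc n) \<omega> < \<eta>"
        using step N_large[of "Suc n"] by linarith
      let ?S = "\<lambda>i. {j \<in> labels. \<psi> j \<noteq> \<psi> i}"
      \<comment> \<open>Each label lies off at least one of two distinct level sets, so the two off
        masses add up to at least 1. Here they add up to less than
        \<open>\<eta> + \<eta> / 2\<close>, hence less than 1.\<close>
      have "1 = (\<Sum>j\<in>?S j0 \<union> ?S j1. fraction (Suc n) j \<omega>)"
        using False by (subst sum_fraction[symmetric, of "Suc n" \<omega>]) (intro sum.cong, auto)
      also have "\<dots> \<le> off_mass j0 (Suc n) \<omega> + off_mass j1 (Suc n) \<omega>"
        unfolding off_mass_def using finite_labels
        by (subst sum.union_inter[symmetric]) (auto intro!: sum_nonneg simp: fraction_nonneg)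
      finally show ?thesis
        using small j1(2) \<eta> by linarith
    qed
  qed
  have "off_count j0 n \<omega> \<le> \<eta> * N n" if n: "n0 \<le> n" for n
  proof -
    have "N n * off_mass j0 n \<omega> \<le> N n * (\<eta> / 2)"
      using stay[OF n] N_pos[of n] by (intro mult_left_mono) auto
    moreover have "of_bool (\<psi> j0 \<noteq> 1) \<le> N n * (\<eta> / 2)"
      using N_large[OF n] N_pos[of n] \<eta> by (simp add: field_simps)
    ultimately show ?thesis
      unfolding off_count_def by (simp add: algebra_simps)
  qed
  with j0 show ?thesis by blast
qed

lemma AE_z_tendsto_0: "AE \<omega> in P. (\<lambda>n. z n \<omega>) \<longlonglongrightarrow> 0"
proof -
  obtain \<eta> where \<eta>: "0 < \<eta>" "\<eta> \<le> 1 / 16"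
    and escape: "\<And>j0 n0. j0 \<in> labels \<Longrightarrow> AE \<omega> in P. \<not> (\<forall>n\<ge>n0. off_count j0 n \<omega> \<le> \<eta> * N n)"
    using AE_not_concentrated by blast
  \<comment> \<open>The dominant level set and the time from which it dominates depend on the path;
    only countably many pairs are possible, so one null set covers them all.\<close>
  have "AE \<omega> in P. \<forall>j0\<in>labels. \<forall>n0. \<not> (\<forall>n\<ge>n0. off_count j0 n \<omega> \<le> \<eta> * N n)"
    using escape by (intro AE_finite_allI finite_labels) (auto simp: AE_all_countable)
  with AE_r_dichotomy show ?thesis
  proof eventually_elim
    case (elim \<omega>)
    then have "(\<lambda>n. r n \<omega>) \<longlonglongrightarrow> 0"
      using persistent_concentration[of \<omega> \<eta>] \<eta> by auto
    from tendsto_real_sqrt[OF this] show ?case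
      by (simp add: r_def tendsto_norm_zero_iff)
  qed
qed

end

section \<open>Fourier inversion on the residues\<close>

text \<open>The \<open>k\<close>-th character of the residues modulo \<open>d\<close>, extended to
  all integers so that it can be evaluated on sums before reduction.\<close>

definition residue_character :: "nat \<Rightarrow> nat \<Rightarrow> int \<Rightarrow> complex" where
  "residue_character d k x = cis (2 * pi * of_int (int k * x) / real d)"

lemma residue_character_eq_1_iff:
  assumes "0 < d"
  shows "residue_character d k x = 1 \<longleftrightarrow> int d dvd int k * x"
proof -
  let ?y = "int k * x"
  have "residue_character d k x = 1 \<longleftrightarrow> (\<exists>n::int. 2 * pi * of_int ?y / real d = of_int (2 * n) * pi)"
    unfolding residue_character_def cis_conv_exp exp_eq_1 by auto
  also have "\<dots> \<longleftrightarrow> (\<exists>n::int. ?y = int d * n)"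
  proof (intro ex_cong1)
    fix n :: int
    have "2 * pi * of_int ?y / real d = of_int (2 * n) * pi \<longleftrightarrow> real_of_int ?y = real_of_int (int d * n)"
      using assms by (simp add: field_simps)
    then show "2 * pi * of_int ?y / real d = of_int (2 * n) * pi \<longleftrightarrow> ?y = int d * n"
      unfolding of_int_eq_iff .
  qed
  finally show ?thesis by (simp add: dvd_def)
qed

lemma residue_character_0: "residue_character d k 0 = 1"
  by (simp add: residue_character_def)

lemma residue_character_add:
  "residue_character d k (x + y) = residue_character d k x * residue_character d k y"
  by (simp add: residue_character_def cis_mult distrib_left add_divide_distrib)

lemma residue_character_mod: "0 < d \<Longrightarrow> residue_character d k (x mod int d) = residue_character d k x"
  using residue_character_add[of d k "int d * (x div int d)" "x mod int d"]
  by (simp add: residue_character_eq_1_iff[THEN iffD2])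

lemma residue_character_power:
  "residue_character d k x ^ n = residue_character d (n * k) x"
  unfolding residue_character_def Complex.DeMoivre by (simp add: mult_ac)

lemma residue_character_sum_list:
  "residue_character d k (sum_list xs) = prod_list (map (residue_character d k) xs)"
  by (induction xs) (simp_all add: residue_character_0 residue_character_add)

text \<open>Orthogonality of characters: the values are the powers of one \<open>d\<close>-th root
  of unity, and their geometric sum vanishes unless that root is 1.\<close>

lemma sum_residue_characters:
  assumes "0 < d"
  shows "(\<Sum>k<d. residue_character d k x) = (if int d dvd x then of_nat d else 0)"
proof -
  let ?w = "residue_character d 1 x"
  have "?w ^ d = 1"
    unfolding residue_character_power using assms by (simp add: residue_character_eq_1_iff)
  moreover have "?w = 1 \<longleftrightarrow> int d dvd x"
    using residue_character_eq_1_iff[OF assms, of 1 x] by simp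
  moreover have "(\<Sum>k<d. residue_character d k x) = (\<Sum>k<d. ?w ^ k)"
    by (simp add: residue_character_power)
  ultimately show ?thesis
    by (cases "?w = 1") (simp_all add: geometric_sum)
qed

text \<open>The residues annihilated by \<open>k\<close> form a subgroup, so containing
  \<open>H\<close> means containing what \<open>H\<close> generates.\<close>

lemma dvd_mult_generate:
  assumes d: "0 < d" and H: "H \<subseteq> carrier (integer_mod_group d)" "\<forall>j\<in>H. int d dvd k * j"
    and x: "x \<in> generate (integer_mod_group d) H"
  shows "int d dvd k * x"
  using x
proof (induction rule: generate.induct)
  case one
  show ?case by simp
next
  case (incl h)
  then show ?case using H by blast
next
  case (inv h)
  then have "inv\<^bsub>integer_mod_group d\<^esub> h = (- h) mod int d"
    using H(1) by (intro inv_integer_mod_group) auto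
  moreover have "int d dvd k * (- h)"
    using H(2) inv by simp
  ultimately show ?case
    by (metis dvd_eq_mod_eq_0 mod_mult_right_eq)
next
  case (eng h1 h2)
  then have "int d dvd k * (h1 + h2)"
    by (simp add: distrib_left)
  then show ?case
    by (simp add: mult_integer_mod_group dvd_eq_mod_eq_0 mod_mult_right_eq)
qed

text \<open>If the character were trivial on all labels present, it would be trivial on the group
  they generate, in particular at the residue 1, and \<open>d\<close> would divide
  \<open>k\<close>.\<close>

lemma character_nontrivial_on_start:
  assumes start: "valid_start d S0" and k: "0 < k" "k < d"
  shows "\<exists>j\<in>carrier (integer_mod_group d). 0 < S0 j \<and> residue_character d k j \<noteq> 1"
proof (rule ccontr)
  let ?H = "{j \<in> carrier (integer_mod_group d). S0 j > 0}"
  have d: "0 < d" using k by simp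
  assume "\<not> ?thesis"
  then have "\<forall>j\<in>?H. int d dvd int k * j"
    using residue_character_eq_1_iff[OF d] by blast
  moreover have "1 \<in> generate (integer_mod_group d) ?H"
    using start k by (simp add: valid_start_def carrier_integer_mod_group)
  ultimately have "int d dvd int k * 1"
    using d by (intro dvd_mult_generate[of d ?H]) auto
  then show False
    using k by (simp add: nat_dvd_not_less)
qed

section \<open>From vanishing Fourier modes to the limiting proportions\<close>

context mau
begin

lemma mau_character_residue_character:
  assumes "k \<in> {0<..<d}"
  shows "mau_character P d S0 X Ms p (residue_character d k)"
proof (unfold_locales)
  fix j :: int and xs :: "int list"
  show "residue_character d k (sum_list xs mod int d) = prod_list (map (residue_character d k) xs)"
    using d by (simp add: residue_character_mod residue_character_sum_list)
  show "residue_character d k j ^ d = 1"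
    unfolding residue_character_power using d by (simp add: residue_character_eq_1_iff)
  show "\<exists>j\<in>labels. 0 < S0 j \<and> residue_character d k j \<noteq> 1"
    using assms start by (intro character_nontrivial_on_start) auto
qed

text \<open>The mode \<open>k = 0\<close> is the total mass 1 and is split off as the leading 1; it
  alone survives in the limit and yields \<open>1 / d\<close>.\<close>

lemma fraction_Fourier_inversion:
  assumes j: "j \<in> labels"
  shows "complex_of_real (fraction n j \<omega>) = (1 + (\<Sum>k\<in>{0<..<d}. residue_character d k (- j) *
    (\<Sum>l\<in>labels. fraction n l \<omega> *\<^sub>R residue_character d k l))) / of_nat d"
proof -
  let ?t = "\<lambda>k. residue_character d k (- j) * (\<Sum>l\<in>labels. fraction n l \<omega> *\<^sub>R residue_character d k l)"
  have "?t 0 = of_real (\<Sum>l\<in>labels. fraction n l \<omega>)"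
    by (simp add: residue_character_def scaleR_conv_of_real)
  then have "?t 0 = 1"
    by (simp add: sum_fraction)
  moreover have "{..<d} = insert 0 {0<..<d}"
    using d by auto
  ultimately have "1 + (\<Sum>k\<in>{0<..<d}. ?t k) = (\<Sum>k<d. ?t k)"
    by simp
  also have "\<dots> = (\<Sum>k<d. \<Sum>l\<in>labels. fraction n l \<omega> *\<^sub>R residue_character d k (l - j))"
    by (simp add: sum_distrib_left residue_character_add[symmetric])
  also have "\<dots> = (\<Sum>l\<in>labels. fraction n l \<omega> *\<^sub>R (\<Sum>k<d. residue_character d k (l - j)))"
    by (subst sum.swap) (simp add: scaleR_sum_right)
  also have "\<dots> = (\<Sum>l\<in>labels. if l = j then fraction n j \<omega> *\<^sub>R of_nat d else 0)"
  proof (intro sum.cong refl)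
    fix l assume "l \<in> labels"
    then have "int d dvd l - j \<longleftrightarrow> l = j"
      using j by (auto simp: labels_eq mod_eq_dvd_iff[symmetric])
    then show "fraction n l \<omega> *\<^sub>R (\<Sum>k<d. residue_character d k (l - j))
        = (if l = j then fraction n j \<omega> *\<^sub>R of_nat d else 0)"
      using d by (simp add: sum_residue_characters)
  qed
  also have "\<dots> = fraction n j \<omega> *\<^sub>R of_nat d"
    using j finite_labels by simp
  finally show ?thesis
    using d by (simp add: scaleR_conv_of_real)
qed

lemma AE_fraction_tendsto:
  assumes "j \<in> labels"
  shows "AE \<omega> in P. (\<lambda>n. fraction n j \<omega>) \<longlonglongrightarrow> 1 / real d"
proof -
  let ?z = "\<lambda>k n \<omega>. \<Sum>l\<in>labels. fraction n l \<omega> *\<^sub>R residue_character d k l"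
  have "AE \<omega> in P. (\<lambda>n. ?z k n \<omega>) \<longlonglongrightarrow> 0" if "k \<in> {0<..<d}" for k
  proof -
    interpret mau_character P d S0 X Ms p "residue_character d k"
      using that by (rule mau_character_residue_character)
    show ?thesis
      using AE_z_tendsto_0 unfolding z_def .
  qed
  then have "AE \<omega> in P. \<forall>k\<in>{0<..<d}. (\<lambda>n. ?z k n \<omega>) \<longlonglongrightarrow> 0"
    by (intro AE_finite_allI) auto
  then show ?thesis
  proof eventually_elim
    case (elim \<omega>)
    then have "(\<lambda>n. (1 + (\<Sum>k\<in>{0<..<d}. residue_character d k (- j) * ?z k n \<omega>)) / of_nat d)
        \<longlonglongrightarrow> (1 + (\<Sum>k\<in>{0<..<d}. residue_character d k (- j) * 0)) / of_nat d"
      using d by (intro tendsto_intros) auto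
    then have "(\<lambda>n. complex_of_real (fraction n j \<omega>)) \<longlonglongrightarrow> complex_of_real (1 / real d)"
      unfolding fraction_Fourier_inversion[OF assms] by simp
    then show ?case
      unfolding tendsto_of_real_iff .
  qed
qed

end

theorem theorem2p2:
  fixes P :: "'a measure" and d :: nat
    and S0 :: "int \<Rightarrow> nat" and X :: "nat \<Rightarrow> 'a \<Rightarrow> int list"
  assumes "prob_space P"
    and "d \<ge> 2"
    and "valid_start d S0"
    and "draw_sequence P d X"
    and "assumption_1 P d S0 X"
    and "assumption_2 P d X"
  shows "\<forall>j \<in> carrier (integer_mod_group d).
           AE \<omega> in P. (\<lambda>n. ball_fraction d S0 X n j \<omega>) \<longlonglongrightarrow> 1 / real d"
proof -
  from assms(6) obtain c C :: nat and m :: "nat \<Rightarrow> nat" and q :: "nat \<Rightarrow> real" where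
    law: "(\<forall>s\<in>{1..c}. 2 \<le> m s \<and> m s \<le> C)" "strict_mono_on {1..c} m"
      "\<forall>s\<in>{1..c}. q s > 0" "(\<Sum>s=1..c. q s) = 1"
      "\<forall>i\<ge>1. \<forall>s\<in>{1..c}. measure P {\<omega> \<in> space P. draw_size X i \<omega> = m s} = q s"
      "\<exists>s\<in>{1..c}. gcd (m s - 1) d = 1"
    unfolding assumption_2_def by (elim conjE exE) (rule that; assumption)
  have m: "2 \<le> m s" and q: "q s > 0" and pq: "1 \<le> i \<Longrightarrow> measure P {\<omega> \<in> space P. draw_size X i \<omega> = m s} = q s"
    if "s \<in> {1..c}" for s i
    using law that by blast+
  have inj: "inj_on m {1..c}"
    using law(2) by (rule strict_mono_on_imp_inj_on)
  \<comment> \<open>The mass function on sizes is read off from stage 1, since all stages share the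
    same law. As \<open>m\<close> is strictly increasing, sums over indices become sums over
    sizes.\<close>
  define p where "p = (\<lambda>k. measure P {\<omega> \<in> space P. draw_size X 1 \<omega> = k})"
  have p: "p (m s) = q s" if "s \<in> {1..c}" for s
    using pq[of s 1] that by (simp add: p_def)
  interpret prob_space P by fact
  interpret mau P d S0 X "m ` {1..c}" p
  proof unfold_locales
    show "(\<Sum>k\<in>m ` {1..c}. p k) = 1"
      unfolding sum.reindex[OF inj] using law(4) by (simp add: p)
    show "\<exists>k\<in>m ` {1..c}. coprime (k - 1) d"
      using law(6) by (auto simp: coprime_iff_gcd_eq_1)
    show "2 \<le> k" if "k \<in> m ` {1..c}" for k
      using that m by auto
    show "0 < p k" if "k \<in> m ` {1..c}" for k
      using that q p by auto
    show "prob {\<omega> \<in> space P. draw_size X i \<omega> = k} = p k" if "1 \<le> i" "k \<in> m ` {1..c}" for i k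
      using that pq p by auto
  qed (use assms in auto)
  show ?thesis
    using AE_fraction_tendsto by blast
qed

end
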